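(* Let $p>0$. For $c_1>0$ and $c_2\in\mathbb{R}$ define $h=h_{c_1,c_2}:\mathbb{C}\to\mathbb{C}$ by $h(0)=0$ and $$h(z)=\begin{cases}\dfrac{z}{|z|}\,|z|^{\,c_1\log\left(\frac1{|z|}\right)-ic_2\log\left(\frac1{|z|}\right)} & \text{if } 0<|z|<\tfrac12,\\[2mm] \dfrac{z}{|z|}\,|z|^{\,c_1\log(2)-ic_2\log(2)} & \text{if } \tfrac12\le |z|<1,\\[2mm] z & \text{if } |z|\ge 1.\end{cases}$$ (1) If $$c_1+\frac{c_2^2}{c_1}<\frac1p,$$ then $h$ is a mapping of finite distortion with $e^{pK_h(z)}\in L^1_{\mathrm{loc}}(\mathbb{C})$, $h(0)=0$ and $h(1)=1$. (2) For every $0<\epsilon\le 1$ the parameters $c_1>0$ and $c_2\in\mathbb{R}$ can be chosen so that $c_1+\frac{c_2^2}{c_1}<\frac1p$ and $$|\arg(h(r))|=\frac{1-\epsilon}{2p}\log^2\left(\frac1r\right)\qquad\text{for every } 0<r<\tfrac12,$$ where $\arg$ is the principal branch of the argument.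
   Context: Mapping of finite distortion: for a domain $\Omega\subset\mathbb{C}$, a sense preserving homeomorphism $f:\Omega\to\mathbb{C}$ (for $\Omega=\mathbb{C}$: a sense preserving homeomorphism of $\mathbb{C}$ onto $\mathbb{C}$) has finite distortion if $f\in W^{1,1}_{\mathrm{loc}}(\Omega)$, its Jacobian satisfies $J_f\in L^1_{\mathrm{loc}}(\Omega)$, and $|Df(z)|^2\le J_f(z)K(z)$ for almost every $z\in\Omega$, for some measurable function $K\ge 1$ that is finite almost everywhere. Here $Df(z)$ is the differential matrix and $|Df(z)|=\max\{|Df(z)e|: e\in\mathbb{C}, |e|=1\}$. The smallest such function $K$ is denoted $K_f$ and called the distortion function of $f$. For $t>0$ and $w\in\mathbb{C}$, $t^{w}=e^{w\log t}$ with the real logarithm $\log t$; $\log^2(x)=(\log x)^2$. Branch of the argument: $\arg(h(z))$ is not the principal value in $(-\pi,\pi]$ of the number $h(z)$; on the positive real axis, $r\mapsto\arg(h(r))$, $r>0$, is the unique continuous real function with $h(r)=|h(r)|e^{i\arg(h(r))}$ and $\arg(h(1))=0$. *)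

theory Defs
  imports "HOL-Complex_Analysis.Complex_Analysis"
begin

definition locally_integrable :: "complex set \<Rightarrow> (complex \<Rightarrow> 'b::euclidean_space) \<Rightarrow> bool" where
  "locally_integrable \<Omega> f \<longleftrightarrow> (\<forall>C. compact C \<and> C \<subseteq> \<Omega> \<longrightarrow> f absolutely_integrable_on C)"

definition sense_preserving :: "complex set \<Rightarrow> (complex \<Rightarrow> complex) \<Rightarrow> bool" where
  "sense_preserving \<Omega> f \<longleftrightarrow>
     (\<forall>z r. 0 < r \<and> cball z r \<subseteq> \<Omega> \<longrightarrow> winding_number (f \<circ> circlepath z r) (f z) = 1)"

text \<open>A function on the plane is of class $C^k$ if all iterated partial derivatives up to
  order $k$ exist and are continuous; \<open>1\<close> and \<open>\<i>\<close> are the two coordinate directions.\<close>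

primrec C_k :: "nat \<Rightarrow> (complex \<Rightarrow> real) \<Rightarrow> bool" where
  "C_k 0 \<phi> \<longleftrightarrow> continuous_on UNIV \<phi>"
| "C_k (Suc k) \<phi> \<longleftrightarrow> (\<forall>z. \<phi> differentiable (at z)) \<and>
     C_k k (\<lambda>z. frechet_derivative \<phi> (at z) 1) \<and>
     C_k k (\<lambda>z. frechet_derivative \<phi> (at z) \<i>)"

definition test_function :: "complex set \<Rightarrow> (complex \<Rightarrow> real) \<Rightarrow> bool" where
  "test_function \<Omega> \<phi> \<longleftrightarrow>
     (\<forall>k. C_k k \<phi>) \<and> compact (closure {z. \<phi> z \<noteq> 0}) \<and> closure {z. \<phi> z \<noteq> 0} \<subseteq> \<Omega>"

definition weak_partial ::
    "complex set \<Rightarrow> complex \<Rightarrow> (complex \<Rightarrow> complex) \<Rightarrow> (complex \<Rightarrow> complex) \<Rightarrow> bool" where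
  "weak_partial \<Omega> b f g \<longleftrightarrow>
     (\<forall>\<phi>. test_function \<Omega> \<phi> \<longrightarrow>
        (LINT z:\<Omega>|lebesgue. frechet_derivative \<phi> (at z) b *\<^sub>R f z)
          = - (LINT z:\<Omega>|lebesgue. \<phi> z *\<^sub>R g z))"

text \<open>\<open>weak_differential \<Omega> f D\<close> says that \<open>f\<close> belongs to $W^{1,1}_{loc}(\Omega)$ and that \<open>D\<close> is
  (a representative of) its differential, the value \<open>D z\<close> being regarded as a real linear map of
  the plane.  The differential is determined up to a null set.\<close>

definition weak_differential ::
    "complex set \<Rightarrow> (complex \<Rightarrow> complex) \<Rightarrow> (complex \<Rightarrow> complex \<Rightarrow> complex) \<Rightarrow> bool" where
  "weak_differential \<Omega> f D \<longleftrightarrow>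
     (\<forall>z\<in>\<Omega>. linear (D z)) \<and> locally_integrable \<Omega> f \<and>
     (\<forall>b\<in>{1, \<i>}. locally_integrable \<Omega> (\<lambda>z. D z b) \<and> weak_partial \<Omega> b f (\<lambda>z. D z b))"

definition jacobian :: "(complex \<Rightarrow> complex \<Rightarrow> complex) \<Rightarrow> complex \<Rightarrow> real" where
  "jacobian D z = Re (D z 1) * Im (D z \<i>) - Im (D z 1) * Re (D z \<i>)"

text \<open>For a linear map of the plane, \<open>onorm\<close> is the maximum of its norm on the unit circle.\<close>

definition distortion_bound ::
    "complex set \<Rightarrow> (complex \<Rightarrow> complex \<Rightarrow> complex) \<Rightarrow> (complex \<Rightarrow> ereal) \<Rightarrow> bool" where
  "distortion_bound \<Omega> D K \<longleftrightarrow>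
     K \<in> borel_measurable (lebesgue_on \<Omega>) \<and> (\<forall>z\<in>\<Omega>. 1 \<le> K z) \<and>
     (AE z in lebesgue_on \<Omega>. K z < \<infinity>) \<and>
     (AE z in lebesgue_on \<Omega>. ereal ((onorm (D z))\<^sup>2) \<le> ereal (jacobian D z) * K z)"

definition finite_distortion :: "complex set \<Rightarrow> (complex \<Rightarrow> complex) \<Rightarrow> bool" where
  "finite_distortion \<Omega> f \<longleftrightarrow>
     open \<Omega> \<and> connected \<Omega> \<and> \<Omega> \<noteq> {} \<and>
     (\<exists>g. homeomorphism \<Omega> (f ` \<Omega>) f g) \<and> (\<Omega> = UNIV \<longrightarrow> f ` \<Omega> = UNIV) \<and>
     sense_preserving \<Omega> f \<and>
     (\<exists>D. weak_differential \<Omega> f D \<and> locally_integrable \<Omega> (jacobian D) \<and>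
          (\<exists>K. distortion_bound \<Omega> D K))"

text \<open>\<open>K\<close> is (a representative of) the distortion function of \<open>f\<close>, that is, the smallest
  admissible function.  Like the differential, it is determined up to a null set, so it is
  given as a relation.\<close>

definition is_distortion_function ::
    "complex set \<Rightarrow> (complex \<Rightarrow> complex) \<Rightarrow> (complex \<Rightarrow> ereal) \<Rightarrow> bool" where
  "is_distortion_function \<Omega> f K \<longleftrightarrow>
     (\<exists>D. weak_differential \<Omega> f D \<and> distortion_bound \<Omega> D K \<and>
          (\<forall>K'. distortion_bound \<Omega> D K' \<longrightarrow> (AE z in lebesgue_on \<Omega>. K z \<le> K' z)))"

text \<open>For \<open>t > 0\<close>, the library's complex power \<open>of_real t powr w\<close> is \<open>exp (w * ln t)\<close> with the
  real logarithm.\<close>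

definition h_map :: "real \<Rightarrow> real \<Rightarrow> complex \<Rightarrow> complex" where
  "h_map c1 c2 z =
     (if z = 0 then 0
      else if cmod z < 1/2 then
        z / of_real (cmod z) * of_real (cmod z) powr
          (of_real (c1 * ln (1 / cmod z)) - \<i> * of_real (c2 * ln (1 / cmod z)))
      else if cmod z < 1 then
        z / of_real (cmod z) * of_real (cmod z) powr
          (of_real (c1 * ln 2) - \<i> * of_real (c2 * ln 2))
      else z)"

definition arg_branch :: "(complex \<Rightarrow> complex) \<Rightarrow> (real \<Rightarrow> real) \<Rightarrow> bool" where
  "arg_branch f a \<longleftrightarrow> continuous_on {0<..} a \<and> a 1 = 0 \<and>
     (\<forall>r>0. f (of_real r) = of_real (cmod (f (of_real r))) * exp (\<i> * of_real (a r)))"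

text \<open>The value at \<open>r > 0\<close> of the unique continuous branch; branches are only
  unique on the positive axis, hence the pointwise description.\<close>

definition arg_on_axis :: "(complex \<Rightarrow> complex) \<Rightarrow> real \<Rightarrow> real" where
  "arg_on_axis f r = (THE t. \<exists>a. arg_branch f a \<and> a r = t)"

end

theory Submission imports Defs begin

text \<open>
  In logarithmic coordinates \<open>h\<close> is \<open>s + i\<theta> \<mapsto> \<phi>(s) + i\<theta>\<close> with
  \<open>s = ln |z|\<close>, where the complex profile \<open>\<phi>\<close> has increasing real part: with \<open>c = c1 - i c2\<close> it
  is \<open>-c s\<^sup>2\<close>, \<open>c s ln 2\<close> and \<open>s\<close> on the three annuli.  Hence \<open>h\<close> has constant distortion on the outer
  annuli, and for \<open>|z| < 1/2\<close> the slope \<open>Q = \<phi>'(s) = 2 c ln (1/|z|)\<close> gives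
  \<open>K \<le> (1 + |Q|\<^sup>2) / Re Q = 2 (c1 + c2\<^sup>2/c1) ln (1/|z|) + O(1)\<close>.  So \<open>exp (p K)\<close> is
  bounded by a multiple of \<open>|z|\<close> to the power \<open>-2p (c1 + c2\<^sup>2/c1)\<close>, an exponent above \<open>-2\<close>.
  Since \<open>exp (Re \<phi>(s) - s) (1 + |Q|)\<close> is bounded, \<open>h\<close> is globally Lipschitz, so its
  pointwise differential is also its weak differential.  The argument on the axis is
  \<open>Im \<phi>(ln r) = c2 ln\<^sup>2 (1/r)\<close>; the choice \<open>c1 = 1/(2p)\<close>, \<open>c2 = (1 - \<epsilon>)/(2p)\<close> proves the second part.
\<close>

section \<open>Weak derivatives of Lipschitz maps\<close>

lemma integrable_lborel_bounded_support:
  fixes f :: "'a::euclidean_space \<Rightarrow> 'b::{banach, second_countable_topology}"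
  assumes "f \<in> borel_measurable borel" "\<And>x. norm x \<le> R \<Longrightarrow> norm (f x) \<le> B" "\<And>x. norm x > R \<Longrightarrow> f x = 0"
  shows "integrable lborel f"
proof -
  have "set_integrable lborel (cball 0 R) (\<lambda>x. f x)"
    unfolding set_integrable_def
  proof (rule integrableI_bounded_set_indicator[of _ _ _ B])
    show "emeasure lborel (cball (0::'a) R) < \<infinity>"
      using emeasure_lborel_cball_finite .
  qed (use assms in auto)
  moreover have "(\<lambda>x. indicator (cball 0 R) x *\<^sub>R f x) = f"
    using assms(3) by (auto simp: fun_eq_iff indicator_def)
  ultimately show ?thesis by (simp add: set_integrable_def)
qed

lemma integrable_lborel_continuous_bounded_support:
  fixes f :: "'a::euclidean_space \<Rightarrow> 'b::{banach, second_countable_topology}"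
  assumes "continuous_on UNIV f" "\<And>x. norm x > R \<Longrightarrow> f x = 0"
  shows "integrable lborel f"
proof -
  have "compact (f ` cball 0 R)"
    by (intro compact_continuous_image continuous_on_subset[OF assms(1)]) auto
  then obtain B where "\<And>x. norm x \<le> R \<Longrightarrow> norm (f x) \<le> B"
    by (force dest!: compact_imp_bounded simp: bounded_iff)
  then show ?thesis
    using assms by (intro integrable_lborel_bounded_support[of f R B]) (auto intro: borel_measurable_continuous_onI)
qed

lemma has_derivative_imp_difference_quotient_tendsto:
  assumes "(F has_derivative F') (at x)"
  shows "(\<lambda>n. real (Suc n) *\<^sub>R (F (x + b /\<^sub>R real (Suc n)) - F x)) \<longlonglongrightarrow> F' b"
proof -
  define t where "t n = inverse (real (Suc n))" for n
  have t: "filterlim t (at 0) sequentially"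
    unfolding t_def filterlim_at using LIMSEQ_inverse_real_of_nat by auto
  have lin: "bounded_linear F'" using assms by (rule has_derivative_bounded_linear)
  have "((\<lambda>t. F (x + t *\<^sub>R b)) has_derivative (\<lambda>t. F' (t *\<^sub>R b))) (at 0)"
    by (rule has_derivative_compose[where g = F and f = "\<lambda>t. x + t *\<^sub>R b"])
      (use assms in \<open>auto intro!: derivative_eq_intros\<close>)
  then have "((\<lambda>y. norm (F (x + y *\<^sub>R b) - F x - F' (y *\<^sub>R b)) / norm y) \<longlongrightarrow> 0) (at 0)"
    by (simp add: has_derivative_iff_norm)
  then have "(\<lambda>n. norm (F (x + t n *\<^sub>R b) - F x - F' (t n *\<^sub>R b)) / norm (t n)) \<longlonglongrightarrow> 0"
    by (rule filterlim_compose) (rule t)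
  moreover have "norm (F (x + t n *\<^sub>R b) - F x - F' (t n *\<^sub>R b)) / norm (t n) =
      norm (real (Suc n) *\<^sub>R (F (x + b /\<^sub>R real (Suc n)) - F x) - F' b)" for n
  proof -
    have "norm (F (x + t n *\<^sub>R b) - F x - F' (t n *\<^sub>R b)) / norm (t n) =
        norm (real (Suc n) *\<^sub>R (F (x + t n *\<^sub>R b) - F x - t n *\<^sub>R F' b))"
      by (simp add: t_def linear_scale[OF bounded_linear.linear[OF lin]] divide_inverse del: of_nat_Suc)
    then show ?thesis by (simp add: t_def scaleR_diff_right del: of_nat_Suc)
  qed
  ultimately show ?thesis by (subst LIM_zero_iff[symmetric]) (simp only: tendsto_norm_zero_iff)
qed

text \<open>Difference quotients of \<open>F\<close> have integral zero by translation invariance, and the Lipschitz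
  condition makes them dominated.\<close>

lemma integral_directional_derivative_eq_0:
  fixes F :: "'a::euclidean_space \<Rightarrow> 'b::{banach, second_countable_topology}"
  assumes lip: "L-lipschitz_on UNIV F" and supp: "\<And>x. norm x > R \<Longrightarrow> F x = 0"
    and der: "AE x in lborel. (F has_derivative F' x) (at x)"
    and meas: "(\<lambda>x. F' x b) \<in> borel_measurable borel"
  shows "(LINT x|lborel. F' x b) = 0"
proof -
  have L: "0 \<le> L" using lipschitz_on_nonneg[OF lip] .
  have cont: "continuous_on UNIV F" using lip by (rule lipschitz_on_continuous_on)
  then have [measurable]: "F \<in> borel_measurable borel" by (rule borel_measurable_continuous_onI)
  have int: "integrable lborel F"
    using cont supp by (rule integrable_lborel_continuous_bounded_support)
  define s where "s n x = real (Suc n) *\<^sub>R (F (x + b /\<^sub>R real (Suc n)) - F x)" for n x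
  have int0: "(LINT x|lborel. s n x) = 0" for n
  proof -
    define c where "c = b /\<^sub>R real (Suc n)"
    have "integrable lborel (\<lambda>x. F (x + c))"
    proof (rule integrable_lborel_continuous_bounded_support[of _ "R + norm c"])
      show "continuous_on UNIV (\<lambda>x. F (x + c))"
        by (intro continuous_on_compose2[OF cont] continuous_intros) auto
      show "F (x + c) = 0" if "norm x > R + norm c" for x
        using that norm_triangle_ineq4[of "x + c" c] by (intro supp) auto
    qed
    moreover have "(LINT x|lborel. F (x + c)) = (LINT x|lborel. F x)"
    proof -
      have "(LINT x|lborel. F x) = (LINT x|distr lborel borel ((+) c). F x)"
        by (simp add: lborel_distr_plus)
      also have "\<dots> = (LINT x|lborel. F (c + x))" by (rule integral_distr) auto
      finally show ?thesis by (simp add: add.commute)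
    qed
    ultimately show ?thesis unfolding s_def by (fold c_def) (simp add: int)
  qed
  have "(\<lambda>n. LINT x|lborel. s n x) \<longlonglongrightarrow> (LINT x|lborel. F' x b)"
  proof (rule integral_dominated_convergence)
    \<comment> \<open>The Lipschitz bound on the increment is \<open>L * norm b / (n + 1)\<close>,
      and the factor \<open>n + 1\<close> in \<open>s\<close> cancels. Every increment is at most
      \<open>norm b\<close> long, so all quotients vanish outside the ball of radius
      \<open>R + norm b\<close>.\<close>
    show "integrable lborel (\<lambda>x. indicator (cball (0::'a) (R + norm b)) x * (L * norm b))"
      by (intro integrable_mult_left integrable_real_indicator)
        (use emeasure_lborel_cball_finite in auto)
    show "AE x in lborel. (\<lambda>n. s n x) \<longlonglongrightarrow> F' x b"
      using der unfolding s_def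
      by eventually_elim (rule has_derivative_imp_difference_quotient_tendsto)
    show "AE x in lborel. norm (s n x) \<le> indicator (cball (0::'a) (R + norm b)) x * (L * norm b)" for n
    proof (rule AE_I2)
      fix x
      define c where "c = b /\<^sub>R real (Suc n)"
      have c: "norm c \<le> norm b"
        by (simp add: c_def divide_le_eq field_simps del: of_nat_Suc) (simp add: algebra_simps)
      show "norm (s n x) \<le> indicator (cball (0::'a) (R + norm b)) x * (L * norm b)"
      proof (cases "norm x \<le> R + norm b")
        case False
        then have "F x = 0" by (intro supp) (use norm_ge_zero[of b] in linarith)
        moreover have "F (x + c) = 0"
          using False c norm_triangle_ineq4[of "x + c" c] by (intro supp) auto
        ultimately show ?thesis using L by (simp add: s_def del: of_nat_Suc flip: c_def)
      next
        case True
        have "norm (F (x + c) - F x) \<le> L * norm c"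
          using lipschitz_onD[OF lip, of "x + c" x] by (simp add: dist_norm)
        then have "real (Suc n) * norm (F (x + c) - F x) \<le> real (Suc n) * (L * norm c)"
          by (intro mult_left_mono) auto
        also have "\<dots> = L * norm b" by (simp add: c_def field_simps del: of_nat_Suc)
        finally show ?thesis using True by (simp add: s_def del: of_nat_Suc flip: c_def)
      qed
    qed
  qed (use meas in \<open>auto simp: s_def\<close>)
  then show ?thesis by (simp add: int0 LIMSEQ_const_iff)
qed

section \<open>Test functions and integration by parts\<close>

text \<open>Collects the first-order data of a test function with one radius \<open>R\<close> for
  its support. Outside the closed ball the function is locally zero, so its derivative vanishes
  there too.\<close>

lemma test_functionE:
  assumes "test_function \<Omega> \<phi>"
  obtains R where "\<And>z. (\<phi> has_derivative frechet_derivative \<phi> (at z)) (at z)"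
    and "\<And>b. b \<in> {1, \<i>} \<Longrightarrow> continuous_on UNIV (\<lambda>z. frechet_derivative \<phi> (at z) b)"
    and "\<And>z. norm z > R \<Longrightarrow> \<phi> z = 0"
    and "\<And>z b. norm z > R \<Longrightarrow> frechet_derivative \<phi> (at z) b = 0"
proof -
  have Ck: "C_k (Suc 0) \<phi>" and "compact (closure {z. \<phi> z \<noteq> 0})"
    using assms by (auto simp: test_function_def simp del: C_k.simps)
  then obtain R where R: "\<And>z. z \<in> closure {z. \<phi> z \<noteq> 0} \<Longrightarrow> norm z \<le> R"
    by (meson bounded_iff compact_imp_bounded)
  have 0: "\<phi> z = 0" if "norm z > R" for z
    using that R[OF closure_subset[THEN subsetD], of z] by auto
  have "frechet_derivative \<phi> (at z) b = 0" if "norm z > R" for z b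
  proof -
    have "((\<lambda>z. 0) has_derivative (\<lambda>_. 0)) (at z)" by simp
    then have "(\<phi> has_derivative (\<lambda>_. 0)) (at z)"
    proof (rule has_derivative_transform_within_open[where s = "- cball 0 R"])
      show "z \<in> - cball 0 R" using that by auto
    qed (auto simp: 0)
    from frechet_derivative_at[OF this] show ?thesis by metis
  qed
  with Ck 0 show ?thesis
    by (intro that[of R]) (auto simp: frechet_derivative_works[symmetric])
qed

text \<open>The two partial derivatives are continuous with compact support, hence bounded. Their
  bounds add up to a bound on the operator norm, and the mean value inequality applies on the convex
  set \<open>UNIV\<close>.\<close>

lemma lipschitz_test_function:
  assumes "test_function \<Omega> \<phi>"
  obtains B where "B-lipschitz_on UNIV \<phi>"
proof -
  obtain R where der: "\<And>z. (\<phi> has_derivative frechet_derivative \<phi> (at z)) (at z)"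
    and cont: "\<And>b. b \<in> {1, \<i>} \<Longrightarrow> continuous_on UNIV (\<lambda>z. frechet_derivative \<phi> (at z) b)"
    and supp: "\<And>z b. norm z > R \<Longrightarrow> frechet_derivative \<phi> (at z) b = 0"
    using test_functionE[OF assms] by metis
  have "\<exists>B\<ge>0. \<forall>z. \<bar>frechet_derivative \<phi> (at z) b\<bar> \<le> B" if "b \<in> {1, \<i>}" for b
  proof -
    have "compact ((\<lambda>z. frechet_derivative \<phi> (at z) b) ` cball 0 R)"
      by (intro compact_continuous_image continuous_on_subset[OF cont[OF that]]) auto
    then obtain B where "\<And>z. norm z \<le> R \<Longrightarrow> \<bar>frechet_derivative \<phi> (at z) b\<bar> \<le> B"
      by (force dest!: compact_imp_bounded simp: bounded_iff)
    then have "\<bar>frechet_derivative \<phi> (at z) b\<bar> \<le> max B 0" for z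
      by (cases "norm z \<le> R") (auto simp: supp le_max_iff_disj)
    then show ?thesis by (intro exI[of _ "max B 0"]) auto
  qed
  from this[of 1] this[of \<i>] obtain B1 B2 where B: "0 \<le> B1" "0 \<le> B2"
    "\<And>z. \<bar>frechet_derivative \<phi> (at z) 1\<bar> \<le> B1" "\<And>z. \<bar>frechet_derivative \<phi> (at z) \<i>\<bar> \<le> B2"
    by auto
  have on: "onorm (frechet_derivative \<phi> (at z)) \<le> B1 + B2" for z
  proof (rule onorm_bound)
    fix v :: complex
    interpret bounded_linear "frechet_derivative \<phi> (at z)"
      using der by (rule has_derivative_bounded_linear)
    have "frechet_derivative \<phi> (at z) v = frechet_derivative \<phi> (at z) (Re v *\<^sub>R 1 + Im v *\<^sub>R \<i>)"
      by (rule arg_cong) (simp add: complex_eq_iff)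
    also have "\<dots> = Re v * frechet_derivative \<phi> (at z) 1 + Im v * frechet_derivative \<phi> (at z) \<i>"
      by (simp add: add scaleR)
    also have "\<bar>\<dots>\<bar> \<le> \<bar>Re v\<bar> * \<bar>frechet_derivative \<phi> (at z) 1\<bar> + \<bar>Im v\<bar> * \<bar>frechet_derivative \<phi> (at z) \<i>\<bar>"
      by (metis abs_mult abs_triangle_ineq)
    also have "\<dots> \<le> norm v * B1 + norm v * B2"
      by (intro add_mono mult_mono B abs_Re_le_cmod abs_Im_le_cmod) auto
    finally show "norm (frechet_derivative \<phi> (at z) v) \<le> (B1 + B2) * norm v"
      by (simp add: algebra_simps)
  qed (use B in auto)
  have "(B1 + B2)-lipschitz_on UNIV \<phi>"
  proof (rule lipschitz_onI)
    fix z w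
    show "dist (\<phi> z) (\<phi> w) \<le> (B1 + B2) * dist z w"
      using differentiable_bound[of UNIV \<phi> "\<lambda>z. frechet_derivative \<phi> (at z)" "B1 + B2" z w] der on
      by (simp add: dist_norm)
  qed (use B in auto)
  then show ?thesis by (rule that)
qed

text \<open>\<open>f\<close> may be unbounded, but only its values on the ball containing the
  support of \<phi> matter. This makes the product globally Lipschitz, so that the vanishing of
  integrals of derivatives applies to it.\<close>

lemma lipschitz_scaleR_bounded_support:
  fixes f :: "'a::euclidean_space \<Rightarrow> 'b::real_normed_vector"
  assumes \<phi>: "B-lipschitz_on UNIV \<phi>" and f: "L-lipschitz_on UNIV f"
    and supp: "\<And>x. norm x > R \<Longrightarrow> \<phi> x = (0::real)"
  obtains M where "M-lipschitz_on UNIV (\<lambda>x. \<phi> x *\<^sub>R f x)"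
proof -
  have B: "0 \<le> B" and L: "0 \<le> L" using \<phi> f by (auto dest: lipschitz_on_nonneg)
  have "compact (f ` cball 0 R)" "compact (\<phi> ` cball 0 R)"
    using \<phi> f by (auto intro!: compact_continuous_image continuous_on_subset[OF lipschitz_on_continuous_on])
  then obtain C1 C2 where "\<And>x. norm x \<le> R \<Longrightarrow> norm (f x) \<le> C1" "\<And>x. norm x \<le> R \<Longrightarrow> \<bar>\<phi> x\<bar> \<le> C2"
    by (force dest!: compact_imp_bounded simp: bounded_iff)
  then have C: "\<And>x. norm x \<le> R \<Longrightarrow> norm (f x) \<le> max C1 0" "\<And>x. \<bar>\<phi> x\<bar> \<le> max C2 0"
    by (auto simp: le_max_iff_disj) (metis abs_zero linorder_not_le supp order_refl)
  define M where "M = B * max C1 0 + max C2 0 * L"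
  have M: "M \<ge> 0" using B L by (simp add: M_def)
  \<comment> \<open>The splitting evaluates \<open>f\<close> by itself only at \<open>x\<close>, so
    it suffices that one of the two points lies in the ball. By symmetry this leaves only the case
    of both points outside, where both products are zero.\<close>
  have *: "norm (\<phi> x *\<^sub>R f x - \<phi> y *\<^sub>R f y) \<le> M * norm (x - y)" if "norm x \<le> R" for x y
  proof -
    have "\<phi> x *\<^sub>R f x - \<phi> y *\<^sub>R f y = (\<phi> x - \<phi> y) *\<^sub>R f x + \<phi> y *\<^sub>R (f x - f y)"
      by (simp add: algebra_simps)
    also have "norm \<dots> \<le> \<bar>\<phi> x - \<phi> y\<bar> * norm (f x) + \<bar>\<phi> y\<bar> * norm (f x - f y)"
      by (rule norm_triangle_le) simp
    also have "\<dots> \<le> (B * norm (x - y)) * max C1 0 + max C2 0 * (L * norm (x - y))"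
      using that lipschitz_onD[OF \<phi>, of x y] lipschitz_onD[OF f, of x y] B L
      by (intro add_mono mult_mono C) (auto simp: dist_norm)
    finally show ?thesis by (simp add: M_def algebra_simps)
  qed
  have "M-lipschitz_on UNIV (\<lambda>x. \<phi> x *\<^sub>R f x)"
  proof (rule lipschitz_onI)
    fix x y
    show "dist (\<phi> x *\<^sub>R f x) (\<phi> y *\<^sub>R f y) \<le> M * dist x y"
      using *[of x y] *[of y x] supp[of x] supp[of y] M
      by (cases "norm x \<le> R"; cases "norm y \<le> R") (auto simp: dist_norm norm_minus_commute)
  qed fact
  then show ?thesis by (rule that)
qed

text \<open>The product of the test function with \<open>f\<close> is Lipschitz with bounded
  support, so its directional derivative integrates to zero. The product rule, valid almost
  everywhere, turns this into integration by parts.\<close>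

lemma weak_partial_lipschitz:
  assumes lip: "L-lipschitz_on UNIV f"
    and der: "AE z in lborel. (f has_derivative D z) (at z)"
    and meas: "(\<lambda>z. D z b) \<in> borel_measurable borel"
    and bound: "\<And>z. norm (D z b) \<le> M" and b: "b \<in> {1, \<i>}"
  shows "weak_partial UNIV b f (\<lambda>z. D z b)"
  unfolding weak_partial_def
proof (intro allI impI)
  fix \<phi> assume \<phi>: "test_function UNIV \<phi>"
  define \<phi>' where "\<phi>' z = frechet_derivative \<phi> (at z)" for z
  from test_functionE[OF \<phi>] obtain R where der\<phi>: "\<And>z. (\<phi> has_derivative \<phi>' z) (at z)"
    and cont: "continuous_on UNIV (\<lambda>z. \<phi>' z b)"
    and supp: "\<And>z. norm z > R \<Longrightarrow> \<phi> z = 0"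
    and supp': "\<And>z. norm z > R \<Longrightarrow> \<phi>' z b = 0"
    unfolding \<phi>'_def using b by metis
  obtain B where B: "B-lipschitz_on UNIV \<phi>" using lipschitz_test_function[OF \<phi>] .
  obtain C where C: "C-lipschitz_on UNIV (\<lambda>z. \<phi> z *\<^sub>R f z)"
    using lipschitz_scaleR_bounded_support[OF B lip supp] .
  have contf: "continuous_on UNIV f" using lip by (rule lipschitz_on_continuous_on)
  have cont\<phi>: "continuous_on UNIV \<phi>" using B by (rule lipschitz_on_continuous_on)
  note [measurable] = meas contf[THEN borel_measurable_continuous_onI]
    cont\<phi>[THEN borel_measurable_continuous_onI] cont[THEN borel_measurable_continuous_onI]
  have int1: "integrable lborel (\<lambda>z. \<phi>' z b *\<^sub>R f z)"
    by (rule integrable_lborel_continuous_bounded_support[of _ R])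
      (auto simp: supp' intro!: continuous_intros cont contf)
  have int2: "integrable lborel (\<lambda>z. \<phi> z *\<^sub>R D z b)"
  proof -
    have "compact (\<phi> ` cball 0 R)"
      by (intro compact_continuous_image continuous_on_subset[OF cont\<phi>]) auto
    then obtain A where A: "\<And>z. norm z \<le> R \<Longrightarrow> \<bar>\<phi> z\<bar> \<le> A"
      by (force dest!: compact_imp_bounded simp: bounded_iff)
    have "norm (\<phi> z *\<^sub>R D z b) \<le> A * M" if "norm z \<le> R" for z
      using mult_mono[OF A[OF that] bound[of z]] A[OF that] by force
    then show ?thesis
      by (intro integrable_lborel_bounded_support[of _ R "A * M"]) (auto simp: supp)
  qed
  have "(LINT z|lborel. \<phi> z *\<^sub>R D z b + \<phi>' z b *\<^sub>R f z) = 0"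
  proof (rule integral_directional_derivative_eq_0[OF C, of R])
    show "AE z in lborel. ((\<lambda>z. \<phi> z *\<^sub>R f z) has_derivative
        (\<lambda>v. \<phi> z *\<^sub>R D z v + \<phi>' z v *\<^sub>R f z)) (at z)"
      using der by eventually_elim (intro has_derivative_scaleR der\<phi>)
  qed (auto simp: supp)
  then have "(LINT z|lborel. \<phi>' z b *\<^sub>R f z) = - (LINT z|lborel. \<phi> z *\<^sub>R D z b)"
    using int1 int2 by (simp add: add_eq_0_iff)
  \<comment> \<open>The computation took place over \<open>lborel\<close>; both integrands are
    Borel, so passing to the completion \<open>lebesgue\<close> does not change the
    integrals.\<close>
  moreover have "(LINT z|lebesgue. \<phi>' z b *\<^sub>R f z) = (LINT z|lborel. \<phi>' z b *\<^sub>R f z)"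
    by (rule integral_completion) auto
  moreover have "(LINT z|lebesgue. \<phi> z *\<^sub>R D z b) = (LINT z|lborel. \<phi> z *\<^sub>R D z b)"
    by (rule integral_completion) auto
  ultimately show "(LINT z:UNIV|lebesgue. frechet_derivative \<phi> (at z) b *\<^sub>R f z)
      = - (LINT z:UNIV|lebesgue. \<phi> z *\<^sub>R D z b)"
    by (simp add: set_lebesgue_integral_def flip: \<phi>'_def)
qed

section \<open>Local integrability\<close>

text \<open>Dyadic comparison: where the norm is between \<open>2 powr -(n + 1)\<close> and
  \<open>2 powr -n\<close>, the weight is at most \<open>2 powr (\<gamma> * (n + 1))\<close>.
  Weighting the whole ball of radius \<open>2 powr -n\<close> by this amount gives a geometric
  series of ratio \<open>2 powr (\<gamma> - d)\<close>, below 1 since \<gamma> is less than the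
  dimension.\<close>

lemma integrable_norm_powr_ball:
  assumes "\<gamma> < real DIM('a)" "0 \<le> \<gamma>"
  shows "integrable lborel (\<lambda>x::'a::euclidean_space. indicator (ball 0 1) x * norm x powr - \<gamma>)"
proof (rule integrableI_nonneg)
  define d where "d = real DIM('a)"
  define V where "V = unit_ball_vol d"
  define u where "u n = ennreal (2 powr (\<gamma> * real (Suc n)))" for n
  define r where "r n = 2 powr - real n" for n
  have V: "V \<ge> 0" by (simp add: V_def d_def)
  have le: "ennreal (indicator (ball 0 1) x * norm x powr - \<gamma>)
      \<le> (\<Sum>n. u n * indicator (cball 0 (r n)) x)" for x :: 'a
  proof (cases "x \<noteq> 0 \<and> norm x < 1")
    case False
    then show ?thesis by (auto simp: indicator_def)
  next
    case True
    define m where "m = - log 2 (norm x)"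
    define n where "n = nat \<lfloor>m\<rfloor>"
    have m: "m \<ge> 0" using True by (simp add: m_def)
    then have n: "real n \<le> m" "m \<le> real (Suc n)" by (auto simp: n_def) linarith
    have x: "norm x = 2 powr - m" using True by (simp add: m_def)
    have "indicator (ball 0 1) x * norm x powr - \<gamma> = 2 powr (\<gamma> * m)"
      using True by (simp add: x powr_powr mult.commute)
    also have "\<dots> \<le> 2 powr (\<gamma> * real (Suc n))"
      using n assms by (intro powr_mono mult_left_mono) auto
    finally have "ennreal (indicator (ball 0 1) x * norm x powr - \<gamma>) \<le> u n * indicator (cball 0 (r n)) x"
      using n by (simp add: u_def r_def x del: of_nat_Suc)
    also have "\<dots> \<le> (\<Sum>n. u n * indicator (cball 0 (r n)) x)"
    proof -
      have "v n \<le> suminf v" for v :: "nat \<Rightarrow> ennreal"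
        using sum_le_suminf[of v "{n}"] by simp
      then show ?thesis .
    qed
    finally show ?thesis .
  qed
  define q where "q = 2 powr (\<gamma> - d)"
  have q: "0 \<le> q" "q < 1" using assms powr_less_mono[of "\<gamma> - d" 0 2] by (simp_all add: q_def d_def)
  have int_term: "(\<integral>\<^sup>+ (x::'a). u n * indicator (cball 0 (r n)) x \<partial>lborel) =
      ennreal (V * 2 powr \<gamma> * q ^ n)" for n
  proof -
    have "(\<integral>\<^sup>+ (x::'a). u n * indicator (cball 0 (r n)) x \<partial>lborel) =
        u n * emeasure lborel (cball (0::'a) (r n))"
      by (rule nn_integral_cmult_indicator) auto
    also have "\<dots> = ennreal (2 powr (\<gamma> * real (Suc n)) * (V * r n ^ DIM('a)))"
      by (simp add: emeasure_cball r_def u_def V_def d_def ennreal_mult'' del: of_nat_Suc)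
    also have "2 powr (\<gamma> * real (Suc n)) * (V * r n ^ DIM('a)) = V * 2 powr \<gamma> * q ^ n"
      by (simp add: r_def q_def d_def powr_realpow[symmetric] powr_powr powr_add[symmetric] algebra_simps)
    finally show ?thesis .
  qed
  have "(\<integral>\<^sup>+ (x::'a). ennreal (indicator (ball 0 1) x * norm x powr - \<gamma>) \<partial>lborel)
      \<le> (\<integral>\<^sup>+ (x::'a). (\<Sum>n. u n * indicator (cball 0 (r n)) x) \<partial>lborel)"
    by (intro nn_integral_mono le)
  also have "\<dots> = (\<Sum>n. \<integral>\<^sup>+ (x::'a). u n * indicator (cball 0 (r n)) x \<partial>lborel)"
    by (rule nn_integral_suminf) (auto intro!: borel_measurable_times_ennreal borel_measurable_indicator)
  also have "\<dots> = (\<Sum>n. ennreal (V * 2 powr \<gamma> * q ^ n))"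
    unfolding int_term ..
  also have "\<dots> = ennreal (\<Sum>n. V * 2 powr \<gamma> * q ^ n)"
    using q V by (intro suminf_ennreal2 summable_mult summable_geometric) auto
  finally show "(\<integral>\<^sup>+ (x::'a). ennreal (indicator (ball 0 1) x * norm x powr - \<gamma>) \<partial>lborel) < \<infinity>"
    by (rule order.strict_trans1) simp
qed (auto intro!: borel_measurable_times borel_measurable_indicator)

lemma locally_integrable_locally_bounded:
  fixes f :: "complex \<Rightarrow> 'b::euclidean_space"
  assumes "f \<in> borel_measurable borel"
    and "\<And>C. compact C \<Longrightarrow> \<exists>B. \<forall>z\<in>C. norm (f z) \<le> B"
  shows "locally_integrable UNIV f"
  unfolding locally_integrable_def
proof (intro allI impI)
  fix C :: "complex set" assume "compact C \<and> C \<subseteq> UNIV"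
  then have C: "compact C" by simp
  with assms(2) obtain B where B: "\<forall>z\<in>C. norm (f z) \<le> B" by blast
  show "f absolutely_integrable_on C"
  proof (rule measurable_bounded_by_integrable_imp_absolutely_integrable)
    show "f \<in> borel_measurable (lebesgue_on C)"
      using assms(1) by (intro measurable_restrict_space1 measurable_completion) auto
    show "C \<in> sets lebesgue" using C by (simp add: compact_imp_closed)
    show "(\<lambda>_. B) integrable_on C"
      using C by (intro integrable_on_const) (simp add: lmeasurable_compact)
  qed (use B in auto)
qed

text \<open>Designed for the exponential of the distortion, which has a power singularity at the
  origin. An exponent below 2, the real dimension of the plane, makes the majorant
  integrable.\<close>

lemma locally_integrable_singular_bound:
  fixes f :: "complex \<Rightarrow> real"
  assumes f: "f \<in> borel_measurable borel" and \<gamma>: "0 \<le> \<gamma>" "\<gamma> < 2" and A: "0 \<le> A"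
    and near: "\<And>z. 0 < norm z \<Longrightarrow> norm z < 1 \<Longrightarrow> \<bar>f z\<bar> \<le> A * norm z powr - \<gamma> + B"
    and far: "\<And>z. z = 0 \<or> 1 \<le> norm z \<Longrightarrow> \<bar>f z\<bar> \<le> B"
  shows "locally_integrable UNIV f"
  unfolding locally_integrable_def
proof (intro allI impI)
  fix C :: "complex set" assume "compact C \<and> C \<subseteq> UNIV"
  then have C: "compact C" by simp
  then have CL: "C \<in> sets lebesgue" by (simp add: compact_imp_closed)
  define w where "w z = A * (indicator (ball 0 1) z * norm z powr - \<gamma>)" for z :: complex
  have "integrable lborel w"
    unfolding w_def using \<gamma> by (intro integrable_mult_right integrable_norm_powr_ball) auto
  then have "integrable lebesgue w" by (subst integrable_completion) auto
  then have "w absolutely_integrable_on C"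
    using set_integrable_subset[of lebesgue UNIV w C] CL by (simp add: set_integrable_def)
  then have "w integrable_on C" by (rule set_lebesgue_integral_eq_integral(1))
  moreover have "(\<lambda>_. B) integrable_on C"
    using C by (intro integrable_on_const) (simp add: lmeasurable_compact)
  ultimately have int: "(\<lambda>z. w z + B) integrable_on C"
    by (rule Henstock_Kurzweil_Integration.integrable_add)
  show "f absolutely_integrable_on C"
  proof (rule measurable_bounded_by_integrable_imp_absolutely_integrable[OF _ CL int])
    show "f \<in> borel_measurable (lebesgue_on C)"
      using f by (intro measurable_restrict_space1 measurable_completion) auto
    fix z
    \<comment> \<open>At \<open>z = 0\<close> the convention \<open>0 powr x = 0\<close> gives
      \<open>w z = 0\<close>, so there the bound has to come from \<open>far\<close>.\<close>
    show "norm (f z) \<le> w z + B"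
      using near[of z] far[of z] by (cases "z = 0 \<or> 1 \<le> norm z") (auto simp: w_def indicator_def)
  qed
qed

lemma locally_integrable_bounded:
  fixes f :: "complex \<Rightarrow> 'b::euclidean_space"
  assumes "f \<in> borel_measurable borel" "\<And>z. norm (f z) \<le> B"
  shows "locally_integrable UNIV f"
  using assms by (intro locally_integrable_locally_bounded) auto

section \<open>The logarithmic profile\<close>

text \<open>The product \<open>min s 0 * max (- s) (ln 2)\<close> encodes the three cases
  \<open>- s^2\<close>, \<open>s * ln 2\<close> and \<open>0\<close> without branching, so
  continuity and measurability follow from the syntax.\<close>

definition log_profile :: "real \<Rightarrow> real \<Rightarrow> real \<Rightarrow> complex" where
  "log_profile c1 c2 s =
     Complex c1 (- c2) * of_real (min s 0 * max (- s) (ln 2)) + of_real (max s 0)"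

text \<open>The derivative of \<open>log_profile\<close> away from the kinks \<open>- ln 2\<close>
  and \<open>0\<close>. The values at the kinks are a convention: they correspond to two circles,
  which are null sets.\<close>

definition log_slope :: "real \<Rightarrow> real \<Rightarrow> real \<Rightarrow> complex" where
  "log_slope c1 c2 s =
     (if s < - ln 2 then of_real (- 2 * s) * Complex c1 (- c2)
      else if s < 0 then of_real (ln 2) * Complex c1 (- c2)
      else 1)"

lemma log_profile_outer [simp]: "0 \<le> s \<Longrightarrow> log_profile c1 c2 s = of_real s"
  by (simp add: log_profile_def)

lemma log_profile_middle:
  "- ln 2 \<le> s \<Longrightarrow> s \<le> 0 \<Longrightarrow>
    log_profile c1 c2 s = Complex c1 (- c2) * of_real (s * ln 2)"
  by (simp add: log_profile_def)

lemma log_profile_inner: "s \<le> - ln 2 \<Longrightarrow> log_profile c1 c2 s = - (Complex c1 (- c2) * of_real (s\<^sup>2))"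
proof -
  assume "s \<le> - ln 2"
  moreover from this have "s \<le> 0" using ln_gt_zero[of "2::real"] by linarith
  moreover have "max (- s) (ln 2) = - s" using calculation by simp
  ultimately show ?thesis
    by (simp add: log_profile_def power2_eq_square)
qed

lemma continuous_on_log_profile: "continuous_on A (log_profile c1 c2)"
  unfolding log_profile_def by (intro continuous_intros)

lemma continuous_on_log_profile' [continuous_intros]:
  "continuous_on A f \<Longrightarrow> continuous_on A (\<lambda>x. log_profile c1 c2 (f x))"
  using continuous_on_compose2[OF continuous_on_log_profile[of UNIV]] by auto

lemma borel_measurable_log_profile [measurable]: "log_profile c1 c2 \<in> borel_measurable borel"
  by (intro borel_measurable_continuous_onI continuous_on_log_profile)

lemma borel_measurable_log_slope [measurable]: "log_slope c1 c2 \<in> borel_measurable borel"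
  unfolding log_slope_def by measurable

lemma has_vector_derivative_log_profile:
  assumes "s \<noteq> - ln 2" "s \<noteq> 0"
  shows "(log_profile c1 c2 has_vector_derivative log_slope c1 c2 s) (at s)"
proof -
  have l2: "ln (2::real) > 0" by simp
  consider "s < - ln 2" | "- ln 2 < s" "s < 0" | "0 < s" using assms by linarith
  then show ?thesis
  proof cases
    case 1
    have "((\<lambda>s. - (Complex c1 (- c2) * of_real (s\<^sup>2))) has_vector_derivative
            log_slope c1 c2 s) (at s)"
      using 1 by (auto intro!: derivative_eq_intros simp: log_slope_def has_vector_derivative_def
          scaleR_conv_of_real)
    then show ?thesis
      by (rule has_vector_derivative_transform_within_open[of _ _ _ "{..<- ln 2}"])
        (use 1 in \<open>auto simp: log_profile_inner\<close>)
  next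
    case 2
    have "((\<lambda>s. Complex c1 (- c2) * of_real (s * ln 2)) has_vector_derivative
            log_slope c1 c2 s) (at s)"
      using 2 by (auto intro!: derivative_eq_intros simp: log_slope_def has_vector_derivative_def
          scaleR_conv_of_real)
    then show ?thesis
      by (rule has_vector_derivative_transform_within_open[of _ _ _ "{- ln 2<..<0}"])
        (use 2 in \<open>auto simp: log_profile_middle\<close>)
  next
    case 3
    then have "\<not> s < - ln 2" using l2 by linarith
    with 3 have "((\<lambda>s. of_real s :: complex) has_vector_derivative log_slope c1 c2 s) (at s)"
      by (auto intro!: derivative_eq_intros simp: log_slope_def has_vector_derivative_def
          scaleR_conv_of_real)
    then show ?thesis
      by (rule has_vector_derivative_transform_within_open[of _ _ _ "{0<..}"])
        (use 3 in \<open>auto simp: log_profile_outer\<close>)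
  qed
qed

lemma Re_log_profile:
  "Re (log_profile c1 c2 s) = c1 * (min s 0 * max (- s) (ln 2)) + max s 0"
  by (simp add: log_profile_def)

text \<open>This is what makes |h(z)| strictly increasing in |z|. Below zero the profile is a
  negative multiple of a product of two nonnegative nonincreasing factors, the first of which
  strictly decreases.\<close>

lemma strict_mono_Re_log_profile:
  assumes "c1 > 0"
  shows "strict_mono (\<lambda>s. Re (log_profile c1 c2 s))"
proof (rule strict_monoI)
  fix s t :: real
  assume "s < t"
  have l2: "ln (2::real) > 0" by simp
  show "Re (log_profile c1 c2 s) < Re (log_profile c1 c2 t)"
  proof (cases "s < 0")
    case False
    then show ?thesis using \<open>s < t\<close> by simp
  next
    case True
    have "(- min t 0) * max (- t) (ln 2) < (- s) * max (- s) (ln 2)"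
      by (rule mult_less_le_imp_less) (use True \<open>s < t\<close> in \<open>auto simp: less_max_iff_disj\<close>)
    then have "c1 * (min s 0 * max (- s) (ln 2)) < c1 * (min t 0 * max (- t) (ln 2))"
      using True assms by simp
    moreover have "max s 0 = 0" "max t 0 \<ge> 0" using True by auto
    ultimately show ?thesis unfolding Re_log_profile by linarith
  qed
qed

lemma Re_log_slope_pos: "c1 > 0 \<Longrightarrow> Re (log_slope c1 c2 s) > 0"
proof -
  assume "c1 > 0"
  have l2: "ln (2::real) > 0" by simp
  then have "s < - ln 2 \<Longrightarrow> s < 0" by linarith
  with \<open>c1 > 0\<close> l2 show ?thesis by (auto simp: log_slope_def mult_neg_pos)
qed

text \<open>\<open>exp (Re (log_profile c1 c2 s) - s)\<close> is |h(z)|/|z| at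
  \<open>s = ln (cmod z)\<close>, and the whole product dominates the norm of the differential. The
  slope grows only linearly as \<open>s\<close> tends to minus infinity, while the first factor
  decays like a Gaussian.\<close>

lemma log_slope_growth:
  assumes "c1 > 0"
  obtains M where "M > 0"
    and "\<And>s. exp (Re (log_profile c1 c2 s) - s) * (1 + cmod (log_slope c1 c2 s)) \<le> M"
proof -
  define C where "C = cmod (Complex c1 (- c2))"
  have C: "C \<ge> 0" by (simp add: C_def)
  have l2: "ln (2::real) > 0" by simp
  \<comment> \<open>One summand for each of the three ranges of \<open>s\<close>, in the order of
    the cases below.\<close>
  define M where "M = exp (1 / c1) * (1 + 2 * C) + 2 * (1 + ln 2 * C) + 2"
  have M: "M > 0" using C l2 by (simp add: M_def add_pos_nonneg add_nonneg_pos)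
  have "exp (Re (log_profile c1 c2 s) - s) * (1 + cmod (log_slope c1 c2 s)) \<le> M" for s
  proof -
    consider "s < - ln 2" | "- ln 2 \<le> s" "s < 0" | "0 \<le> s" by linarith
    then show ?thesis
    proof cases
      case 1
      then have s: "s < 0" using l2 by linarith
      have "1 + cmod (log_slope c1 c2 s) = 1 + (- 2 * s) * C"
        using 1 s by (simp add: log_slope_def norm_mult C_def)
      also have "\<dots> \<le> (1 + 2 * C) * (1 + (- s))"
        using C s by (simp add: algebra_simps)
      also have "\<dots> \<le> (1 + 2 * C) * exp (- s)"
        by (intro mult_left_mono exp_ge_add_one_self) (use C in auto)
      finally have "exp (Re (log_profile c1 c2 s) - s) * (1 + cmod (log_slope c1 c2 s))
          \<le> exp (Re (log_profile c1 c2 s) - s) * ((1 + 2 * C) * exp (- s))"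
        by (intro mult_left_mono) auto
      also have "\<dots> = exp (- (c1 * s\<^sup>2) - 2 * s) * (1 + 2 * C)"
        using 1 by (simp add: log_profile_inner mult_ac flip: exp_add)
      also have "\<dots> \<le> exp (1 / c1) * (1 + 2 * C)"
      proof -
        \<comment> \<open>Completing the square bounds the exponent
          \<open>- c1 * s^2 - 2 * s\<close> by its maximum \<open>1 / c1\<close>.\<close>
        have "0 \<le> c1 * (s + 1 / c1)\<^sup>2" using assms by simp
        also have "\<dots> = c1 * s\<^sup>2 + 2 * s + 1 / c1"
          using assms by (simp add: power2_eq_square field_simps)
        finally show ?thesis using C by (intro mult_right_mono) auto
      qed
      also have "\<dots> \<le> M" using C l2 by (simp add: M_def)
      finally show ?thesis .
    next
      case 2
      have "Re (log_profile c1 c2 s) \<le> 0"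
        using 2 assms l2 by (simp add: log_profile_middle mult_nonneg_nonpos mult_nonpos_nonneg)
      then have "exp (Re (log_profile c1 c2 s) - s) \<le> exp (ln 2)"
        using 2 by (subst exp_le_cancel_iff) linarith
      moreover have "cmod (log_slope c1 c2 s) = ln 2 * C"
        using 2 l2 by (simp add: log_slope_def norm_mult C_def)
      ultimately have "exp (Re (log_profile c1 c2 s) - s) * (1 + cmod (log_slope c1 c2 s))
          \<le> 2 * (1 + ln 2 * C)"
        by (intro mult_mono) (use C in auto)
      also have "\<dots> \<le> M" using C by (simp add: M_def)
      finally show ?thesis .
    next
      case 3
      then have "\<not> s < - ln 2" using l2 by linarith
      with 3 have "exp (Re (log_profile c1 c2 s) - s) * (1 + cmod (log_slope c1 c2 s)) = 2"
        by (simp add: log_slope_def)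
      also have "\<dots> \<le> M" using C l2 by (simp add: M_def)
      finally show ?thesis .
    qed
  qed
  with M show ?thesis by (rule that)
qed

text \<open>One formula for all cases. Pulling out \<open>z\<close> instead of its direction makes
  it hold at the origin as well.\<close>

lemma h_map_conv_log_profile:
  "h_map c1 c2 z = z * exp (log_profile c1 c2 (ln (cmod z)) - of_real (ln (cmod z)))"
proof (cases "z = 0")
  case True
  then show ?thesis by (simp add: h_map_def)
next
  case False
  define s where "s = ln (cmod z)"
  have r: "cmod z = exp s" using False by (simp add: s_def)
  have "exp (of_real s) = (of_real (cmod z) :: complex)" by (simp add: r exp_of_real)
  then have rhs: "z * exp (log_profile c1 c2 s - of_real s) = z / of_real (cmod z) * exp (log_profile c1 c2 s)"
    by (simp add: exp_diff)
  have pw: "of_real (cmod z) powr w = exp (w * of_real s)" for w :: complex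
    using False by (simp add: powr_def s_def Ln_of_real)
  have half: "cmod z < 1/2 \<longleftrightarrow> s < - ln 2"
    by (metis False divide_inverse exp_less_cancel_iff exp_ln exp_minus mult_1 r zero_less_numeral)
  have one: "cmod z < 1 \<longleftrightarrow> s < 0"
    by (simp add: r)
  consider "s < - ln 2" | "\<not> s < - ln 2" "s < 0" | "\<not> s < - ln 2" "\<not> s < 0" by linarith
  then show ?thesis
  proof cases
    case 1
    then have "h_map c1 c2 z = z / of_real (cmod z) *
        exp ((of_real (c1 * ln (1 / cmod z)) - \<i> * of_real (c2 * ln (1 / cmod z))) * of_real s)"
      using False half by (simp add: h_map_def pw)
    also have "(of_real (c1 * ln (1 / cmod z)) - \<i> * of_real (c2 * ln (1 / cmod z))) * of_real s =
        log_profile c1 c2 s"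
      using 1 False by (simp add: log_profile_inner s_def ln_div complex_eq_iff power2_eq_square)
    finally show ?thesis using rhs by (simp add: s_def)
  next
    case 2
    then have "h_map c1 c2 z = z / of_real (cmod z) *
        exp ((of_real (c1 * ln 2) - \<i> * of_real (c2 * ln 2)) * of_real s)"
      using False half one by (simp add: h_map_def pw)
    also have "(of_real (c1 * ln 2) - \<i> * of_real (c2 * ln 2)) * of_real s = log_profile c1 c2 s"
      using 2 by (simp add: log_profile_middle complex_eq_iff power2_eq_square)
    finally show ?thesis using rhs by (simp add: s_def)
  next
    case 3
    then have "log_profile c1 c2 s = of_real s" by simp
    then have "z * exp (log_profile c1 c2 s - of_real s) = z" by simp
    moreover have "h_map c1 c2 z = z"
      using 3 False half one by (simp only: h_map_def if_False simp_thms)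
    ultimately show ?thesis by (simp only: s_def)
  qed
qed

section \<open>Lipschitz continuity and topology\<close>

text \<open>The fundamental theorem of calculus for continuous functions tolerates finitely many
  exceptional points; this absorbs the kinks of the profile.\<close>

lemma lipschitz_on_if_bounded_vector_derivative:
  fixes g :: "real \<Rightarrow> 'a::euclidean_space"
  assumes "is_interval I" "finite S" "continuous_on I g" "0 \<le> M"
    and der: "\<And>x. x \<in> I - S \<Longrightarrow> (g has_vector_derivative g' x) (at x)"
    and bound: "\<And>x. x \<in> I \<Longrightarrow> norm (g' x) \<le> M"
  shows "M-lipschitz_on I g"
proof -
  have *: "norm (g y - g x) \<le> M * (y - x)" if "x \<in> I" "y \<in> I" "x \<le> y" for x y
  proof -
    have sub: "{x..y} \<subseteq> I"
      using that assms(1) by (metis atLeastAtMost_iff mem_is_interval_1_I subsetI)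
    have "(g' has_integral (g y - g x)) {x..y}"
      by (rule fundamental_theorem_of_calculus_interior_strong[OF \<open>finite S\<close>])
        (use that sub in \<open>auto intro!: der intro: continuous_on_subset[OF assms(3)]\<close>)
    then have "norm (g y - g x) \<le> M * measure lborel (cbox x y)"
      by (intro has_integral_bound[of M g']) (use sub bound \<open>0 \<le> M\<close> in auto)
    with that show ?thesis by simp
  qed
  show ?thesis
  proof (rule lipschitz_onI)
    fix x y assume "x \<in> I" "y \<in> I"
    then show "dist (g x) (g y) \<le> M * dist x y"
      using *[of x y] *[of y x]
      by (cases "x \<le> y") (auto simp: dist_norm norm_minus_commute abs_if)
  qed fact
qed

text \<open>Moving from \<open>w\<close> to \<open>z\<close> is split into a radial change, costing
  \<open>M\<close>, and a change of direction at the smaller radius, costing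
  \<open>2 * M\<close>.\<close>

lemma lipschitz_radial_extension:
  fixes f :: "complex \<Rightarrow> complex" and g :: "real \<Rightarrow> complex"
  assumes lip: "M-lipschitz_on {0<..} g" and bd: "\<And>r. r > 0 \<Longrightarrow> norm (g r) \<le> M * r"
    and f0: "f 0 = 0" and f: "\<And>z. z \<noteq> 0 \<Longrightarrow> f z = sgn z * g (cmod z)"
  shows "(3 * M)-lipschitz_on UNIV f"
proof -
  have M: "0 \<le> M" using lipschitz_on_nonneg[OF lip] .
  have *: "dist (f z) (f w) \<le> 3 * M * dist z w" if "cmod z \<le> cmod w" for z w
  proof (cases "z = 0")
    case True
    show ?thesis
    proof (cases "w = 0")
      case False
      have "norm (f w) = norm (g (cmod w))" using False by (simp add: f norm_mult norm_sgn)
      also have "\<dots> \<le> M * cmod w" using False by (intro bd) simp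
      also have "\<dots> \<le> 3 * M * cmod w" using M by (simp add: mult_right_mono)
      finally show ?thesis using True by (simp add: f0)
    qed (use True M in auto)
  next
    case False
    with that have w: "w \<noteq> 0" by auto
    define r s where "r = cmod z" and "s = cmod w"
    have rs: "0 < r" "r \<le> s" "0 < s" using False w that by (auto simp: r_def s_def)
    have "f z - f w = sgn w * (g r - g s) + (sgn z - sgn w) * g r"
      using False w by (simp add: f r_def s_def algebra_simps)
    then have "dist (f z) (f w) \<le> norm (sgn w * (g r - g s)) + norm ((sgn z - sgn w) * g r)"
      by (metis dist_norm norm_triangle_ineq)
    moreover have "norm (sgn w * (g r - g s)) \<le> M * dist z w"
    proof -
      have "norm (sgn w * (g r - g s)) = dist (g r) (g s)"
        using w by (simp add: norm_mult norm_sgn dist_norm)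
      also have "\<dots> \<le> M * dist r s" using lipschitz_onD[OF lip] rs by auto
      also have "\<dots> \<le> M * dist z w"
        using M by (intro mult_left_mono) (simp_all add: r_def s_def dist_norm norm_triangle_ineq3)
      finally show ?thesis .
    qed
    moreover have "norm ((sgn z - sgn w) * g r) \<le> M * (2 * dist z w)"
    proof -
      have "norm ((sgn z - sgn w) * g r) \<le> norm (sgn z - sgn w) * (M * r)"
        unfolding norm_mult by (intro mult_left_mono bd) (use rs in auto)
      also have "\<dots> = M * norm (r *\<^sub>R (sgn z - sgn w))" using rs by simp
      \<comment> \<open>At radius \<open>r\<close> the change of direction is the displacement
        \<open>z - w\<close> corrected by the radial gap \<open>s - r\<close>; each part has norm at
        most \<open>dist z w\<close>.\<close>
      also have "r *\<^sub>R (sgn z - sgn w) = (z - w) + (s - r) *\<^sub>R sgn w"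
        using False w by (simp add: sgn_div_norm r_def s_def algebra_simps)
      also have "norm \<dots> \<le> norm (z - w) + norm ((s - r) *\<^sub>R sgn w)"
        by (rule norm_triangle_ineq)
      also have "\<dots> \<le> 2 * dist z w"
        using w norm_triangle_ineq3[of w z]
        by (simp add: norm_sgn dist_norm r_def s_def norm_minus_commute[of z w])
      finally show ?thesis using M by (simp add: mult_left_mono)
    qed
    ultimately show ?thesis by simp
  qed
  show ?thesis
  proof (rule lipschitz_onI)
    fix z w :: complex
    show "dist (f z) (f w) \<le> 3 * M * dist z w"
      using *[of z w] *[of w z] by (cases "cmod z \<le> cmod w") (auto simp: dist_commute)
  qed (use M in auto)
qed

text \<open>The radial part is \<open>g = exp o log_profile o ln\<close>. With
  \<open>s = ln r\<close>, both |g(r)|/r and |g'(r)| are controlled by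
  \<open>log_slope_growth\<close>: the former is the exponential factor, the latter that factor
  times the norm of the slope. The excluded radii 1/2 and 1 are the kinks.\<close>

lemma lipschitz_h_map:
  assumes "c1 > 0"
  obtains L where "L-lipschitz_on UNIV (h_map c1 c2)"
proof -
  obtain M where M: "M > 0"
    and bd: "\<And>s. exp (Re (log_profile c1 c2 s) - s) * (1 + cmod (log_slope c1 c2 s)) \<le> M"
    using log_slope_growth[OF assms] by blast
  have bd1: "exp (Re (log_profile c1 c2 s) - s) \<le> M" for s
  proof -
    have "exp (Re (log_profile c1 c2 s) - s) \<le>
        exp (Re (log_profile c1 c2 s) - s) * (1 + cmod (log_slope c1 c2 s))"
      by (simp add: algebra_simps)
    with bd[of s] show ?thesis by linarith
  qed
  have bd2: "exp (Re (log_profile c1 c2 s) - s) * cmod (log_slope c1 c2 s) \<le> M" for s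
  proof -
    have "exp (Re (log_profile c1 c2 s) - s) * cmod (log_slope c1 c2 s) \<le>
        exp (Re (log_profile c1 c2 s) - s) * (1 + cmod (log_slope c1 c2 s))"
      by (simp add: algebra_simps)
    with bd[of s] show ?thesis by linarith
  qed
  define g where "g r = exp (log_profile c1 c2 (ln r))" for r :: real
  define g' where "g' r = exp (log_profile c1 c2 (ln r)) * (log_slope c1 c2 (ln r) / of_real r)" for r
  have "M-lipschitz_on {0<..} g"
  proof (rule lipschitz_on_if_bounded_vector_derivative[where S = "{1/2, 1}" and g' = g'])
    show "continuous_on {0<..} g"
      unfolding g_def by (intro continuous_intros) auto
    fix r :: real
    show "(g has_vector_derivative g' r) (at r)" if "r \<in> {0<..} - {1/2, 1}"
    proof -
      have "ln r \<noteq> - ln 2" using that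
        by (metis DiffE divide_inverse exp_ln exp_minus greaterThan_iff insertCI mult_1 zero_less_numeral)
      moreover have "ln r \<noteq> 0" using that by simp
      ultimately have "(log_profile c1 c2 has_vector_derivative log_slope c1 c2 (ln r)) (at (ln r))"
        by (rule has_vector_derivative_log_profile)
      moreover have "(ln has_vector_derivative inverse r) (at r)"
        using that DERIV_ln[of r] by (simp add: has_real_derivative_iff_has_vector_derivative)
      ultimately have "((log_profile c1 c2 \<circ> ln) has_vector_derivative
          inverse r *\<^sub>R log_slope c1 c2 (ln r)) (at r)"
        by (intro vector_diff_chain_at)
      from field_vector_diff_chain_at[OF this DERIV_exp]
      show ?thesis by (simp add: g_def[abs_def] g'_def o_def scaleR_conv_of_real field_simps)
    qed
    show "norm (g' r) \<le> M" if "r \<in> {0<..}"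
      using that bd2[of "ln r"] by (simp add: g'_def norm_mult norm_divide exp_diff)
  qed (use M in \<open>auto simp: is_interval_1\<close>)
  moreover have "norm (g r) \<le> M * r" if "r > 0" for r
    using bd1[of "ln r"] that by (simp add: g_def exp_diff field_simps)
  ultimately have "(3 * M)-lipschitz_on UNIV (h_map c1 c2)"
  proof (rule lipschitz_radial_extension)
    show "h_map c1 c2 0 = 0" by (simp add: h_map_def)
    fix z :: complex assume "z \<noteq> 0"
    then show "h_map c1 c2 z = sgn z * g (cmod z)"
      by (simp add: h_map_conv_log_profile g_def exp_diff exp_of_real sgn_div_norm
          scaleR_conv_of_real field_simps)
  qed
  then show ?thesis by (rule that)
qed

section \<open>Orientation and bijectivity via a homotopy to the identity\<close>

text \<open>Interpolates linearly, on the logarithmic scale, between the identity (\<open>t = 0\<close>) and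
  \<^term>\<open>h_map c1 c2\<close> (\<open>t = 1\<close>).\<close>

definition log_homotopy :: "real \<Rightarrow> real \<Rightarrow> real \<Rightarrow> complex \<Rightarrow> complex" where
  "log_homotopy c1 c2 t z =
     z * exp (of_real t * (log_profile c1 c2 (ln (cmod z)) - of_real (ln (cmod z))))"

lemma log_homotopy_0 [simp]: "log_homotopy c1 c2 0 z = z"
  and log_homotopy_1 [simp]: "log_homotopy c1 c2 1 z = h_map c1 c2 z"
  by (simp_all add: log_homotopy_def h_map_conv_log_profile)

text \<open>The logarithm of the modulus of the image is \<open>k (ln (cmod z))\<close>, where
  \<open>k\<close> is a convex combination of two strictly increasing functions. So the image
  determines |z|, and then the common nonzero exponential factor cancels.\<close>

lemma inj_log_homotopy:
  assumes "c1 > 0" "0 \<le> t" "t \<le> 1"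
  shows "inj (log_homotopy c1 c2 t)"
proof (rule injI)
  fix z w
  assume eq: "log_homotopy c1 c2 t z = log_homotopy c1 c2 t w"
  show "z = w"
  proof (cases "z = 0 \<or> w = 0")
    case True
    then show ?thesis using eq by (auto simp: log_homotopy_def)
  next
    case False
    define k where "k s = (1 - t) * s + t * Re (log_profile c1 c2 s)" for s
    have "k a < k b" if "a < b" for a b
    proof (cases "t = 0")
      case True
      then show ?thesis using that by (simp add: k_def)
    next
      case False
      have "t * Re (log_profile c1 c2 a) < t * Re (log_profile c1 c2 b)"
        using strict_monoD[OF strict_mono_Re_log_profile[OF assms(1)] that] False assms by simp
      moreover have "(1 - t) * a \<le> (1 - t) * b" using that assms by (simp add: mult_left_mono)
      ultimately show ?thesis by (simp add: k_def)
    qed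
    then have inj: "a = b" if "k a = k b" for a b
      using that by (metis less_irrefl linorder_neqE)
    have "cmod (log_homotopy c1 c2 t z) = exp (k (ln (cmod z)))" if "z \<noteq> 0" for z
    proof -
      have "cmod (log_homotopy c1 c2 t z) =
          exp (ln (cmod z)) * exp (t * (Re (log_profile c1 c2 (ln (cmod z))) - ln (cmod z)))"
        using that by (simp add: log_homotopy_def norm_mult)
      also have "\<dots> = exp (k (ln (cmod z)))"
        unfolding k_def exp_add[symmetric] by (simp add: algebra_simps)
      finally show ?thesis .
    qed
    with eq False have "k (ln (cmod z)) = k (ln (cmod w))" by (metis exp_inj_iff)
    then have "ln (cmod z) = ln (cmod w)" by (rule inj)
    with eq show ?thesis by (simp add: log_homotopy_def)
  qed
qed

text \<open>Away from \<open>z = 0\<close> this is clear from the formula. At the origin the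
  logarithm is discontinuous, and a linear bound in |z| that is uniform in \<open>t\<close> replaces
  it.\<close>

lemma continuous_on_log_homotopy:
  assumes "c1 > 0"
  shows "continuous_on ({0..1} \<times> UNIV) (\<lambda>x. log_homotopy c1 c2 (fst x) (snd x))"
proof -
  obtain M where M: "M > 0"
    and bd: "\<And>s. exp (Re (log_profile c1 c2 s) - s) * (1 + cmod (log_slope c1 c2 s)) \<le> M"
    using log_slope_growth[OF assms] by blast
  define S where "S = {0..1::real} \<times> (UNIV :: complex set)"
  have bound: "cmod (log_homotopy c1 c2 t z) \<le> (M + 1) * cmod z" if "t \<in> {0..1}" for t z
  proof -
    define e where "e = Re (log_profile c1 c2 (ln (cmod z))) - ln (cmod z)"
    have "exp e \<le> exp e * (1 + cmod (log_slope c1 c2 (ln (cmod z))))" by (simp add: algebra_simps)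
    with bd have "exp e \<le> M" unfolding e_def by (rule order_trans[rotated])
    \<comment> \<open>Since \<open>t * e\<close> lies between \<open>0\<close> and \<open>e\<close>,
      its exponential is at most the larger of \<open>1\<close> and \<open>exp e\<close>.\<close>
    moreover have "exp (t * e) \<le> exp e + 1"
    proof (cases "e \<ge> 0")
      case True
      then have "t * e \<le> e" using that by (simp add: mult_left_le_one_le)
      then have "exp (t * e) \<le> exp e" by simp
      then show ?thesis by linarith
    next
      case False
      then have "t * e \<le> 0" using that by (simp add: mult_nonneg_nonpos)
      then have "exp (t * e) \<le> 1" by simp
      then show ?thesis by (simp add: add_increasing)
    qed
    ultimately have "exp (t * e) \<le> M + 1" by linarith
    then show ?thesis
      by (simp add: log_homotopy_def norm_mult mult_left_mono mult.commute flip: e_def)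
  qed
  have "continuous (at x within S) (\<lambda>x. log_homotopy c1 c2 (fst x) (snd x))" if "x \<in> S" for x
  proof (cases "snd x = 0")
    case False
    have "continuous_on (UNIV \<times> - {0}) (\<lambda>x. log_homotopy c1 c2 (fst x) (snd x))"
      unfolding log_homotopy_def by (intro continuous_intros) auto
    moreover have "open (UNIV \<times> - {0} :: (real \<times> complex) set)" by (intro open_Times) auto
    moreover have "x \<in> UNIV \<times> - {0}" using False by (cases x) auto
    ultimately show ?thesis
      by (metis continuous_at_imp_continuous_at_within continuous_on_eq_continuous_at)
  next
    case True
    have "((\<lambda>x. log_homotopy c1 c2 (fst x) (snd x)) \<longlongrightarrow> 0) (at x within S)"
    proof (rule Lim_null_comparison)
      show "\<forall>\<^sub>F x in at x within S. norm (log_homotopy c1 c2 (fst x) (snd x)) \<le> (M + 1) * cmod (snd x)"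
        unfolding eventually_at_filter by (rule always_eventually) (auto simp: S_def intro: bound)
      have "((\<lambda>x. (M + 1) * cmod (snd x)) \<longlongrightarrow> (M + 1) * cmod (snd x)) (at x within S)"
        by (intro tendsto_intros)
      then show "((\<lambda>x. (M + 1) * cmod (snd x)) \<longlongrightarrow> 0) (at x within S)" using True by simp
    qed
    then show ?thesis using True by (simp add: continuous_within log_homotopy_def)
  qed
  then show ?thesis by (simp add: S_def continuous_on_eq_continuous_within)
qed

text \<open>Translate the image of the circle at time \<open>t\<close> by the image of its centre.
  Injectivity at every time keeps this loop away from 0, so its winding number stays that of the
  circle itself, namely 1.\<close>

lemma sense_preserving_h_map:
  assumes "c1 > 0"
  shows "sense_preserving UNIV (h_map c1 c2)"
  unfolding sense_preserving_def
proof (intro allI impI)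
  fix z :: complex and r :: real
  assume "0 < r \<and> cball z r \<subseteq> UNIV"
  then have r: "0 < r" by simp
  let ?H = "log_homotopy c1 c2"
  have "homotopic_loops (- {0}) (\<lambda>s. circlepath z r s - z)
          (\<lambda>s. (h_map c1 c2 \<circ> circlepath z r) s - h_map c1 c2 z)"
    unfolding homotopic_loops
  proof (intro exI[of _ "\<lambda>x. ?H (fst x) (circlepath z r (snd x)) - ?H (fst x) z"] conjI ballI)
    have "continuous_on ({0..1} \<times> {0..1}) (\<lambda>x. ?H (fst (fst x, circlepath z r (snd x)))
        (snd (fst x, circlepath z r (snd x))))"
      by (rule continuous_on_compose2[OF continuous_on_log_homotopy[OF assms]])
        (auto simp: circlepath intro!: continuous_intros)
    moreover have "continuous_on ({0..1} \<times> {0..1}) (\<lambda>x. ?H (fst (fst x, z)) (snd (fst x, z)))"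
      by (rule continuous_on_compose2[OF continuous_on_log_homotopy[OF assms]])
        (auto intro!: continuous_intros)
    ultimately show "continuous_on ({0..1} \<times> {0..1})
        (\<lambda>x. ?H (fst x) (circlepath z r (snd x)) - ?H (fst x) z)"
      by (intro continuous_intros) auto
    have "?H t (circlepath z r s) \<noteq> ?H t z" if "t \<in> {0..1}" for t s
    proof -
      have "circlepath z r s \<noteq> z" using r by (simp add: circlepath)
      then show ?thesis using inj_log_homotopy[OF assms, of t] that by (auto dest: injD)
    qed
    then show "(\<lambda>x. ?H (fst x) (circlepath z r (snd x)) - ?H (fst x) z)
        \<in> {0..1} \<times> {0..1} \<rightarrow> - {0}"
      by auto
    show "pathfinish ((\<lambda>x. ?H (fst x) (circlepath z r (snd x)) - ?H (fst x) z) \<circ> Pair t) =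
        pathstart ((\<lambda>x. ?H (fst x) (circlepath z r (snd x)) - ?H (fst x) z) \<circ> Pair t)" for t
      by (simp add: pathfinish_def pathstart_def circlepath)
  qed auto
  then have "winding_number (\<lambda>s. circlepath z r s - z) 0 =
      winding_number (\<lambda>s. (h_map c1 c2 \<circ> circlepath z r) s - h_map c1 c2 z) 0"
    by (rule winding_number_homotopic_loops)
  then show "winding_number (h_map c1 c2 \<circ> circlepath z r) (h_map c1 c2 z) = 1"
    using winding_number_circlepath_centre[OF r, of z] by (metis winding_number_offset)
qed

text \<open>First solve for the modulus by the intermediate value theorem, then undo the complex
  factor, which depends on the modulus alone.\<close>

lemma surj_h_map:
  assumes "c1 > 0"
  shows "surj (h_map c1 c2)"
unfolding surj_def
proof
  fix w :: complex
  show "\<exists>z. w = h_map c1 c2 z"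
  proof (cases "w = 0")
    case True
    then have "w = h_map c1 c2 0" by (simp add: h_map_def)
    then show ?thesis ..
  next
    case False
    have l2: "ln (2::real) > 0" by simp
    obtain s where s: "Re (log_profile c1 c2 s) = ln (cmod w)"
    proof (cases "ln (cmod w) \<ge> 0")
      case True
      then show ?thesis by (intro that[of "ln (cmod w)"]) simp
    next
      case w: False
      \<comment> \<open>\<open>a\<close> solves the equation of the middle range,
        \<open>c1 * a * ln 2 = ln (cmod w)\<close>. For negative arguments the true profile lies on
        or below that line, so \<open>a\<close> is a valid left end point.\<close>
      define a where "a = ln (cmod w) / (c1 * ln 2)"
      have a: "a \<le> 0" using w assms l2 by (simp add: a_def divide_nonpos_pos)
      have "a * max (- a) (ln 2) \<le> a * ln 2" using a by (intro mult_left_mono_neg) auto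
      then have "c1 * (a * max (- a) (ln 2)) \<le> c1 * (a * ln 2)" using assms by simp
      also have "\<dots> = ln (cmod w)" using assms l2 by (simp add: a_def)
      finally have "Re (log_profile c1 c2 a) \<le> ln (cmod w)" using a by (simp add: Re_log_profile)
      moreover have "ln (cmod w) \<le> Re (log_profile c1 c2 0)" using w by simp
      moreover have "continuous_on {a..0} (\<lambda>s. Re (log_profile c1 c2 s))"
        by (intro continuous_intros)
      ultimately show ?thesis using IVT'[of "\<lambda>s. Re (log_profile c1 c2 s)"] a that by metis
    qed
    define z where "z = w * exp (of_real s - log_profile c1 c2 s)"
    have "cmod z = cmod w * exp (s - ln (cmod w))" by (simp add: z_def norm_mult s)
    also have "\<dots> = exp s" using False by (simp add: exp_diff)
    finally have "w = h_map c1 c2 z"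
      by (simp add: h_map_conv_log_profile z_def exp_diff)
    then show ?thesis ..
  qed
qed

lemma inj_h_map: "c1 > 0 \<Longrightarrow> inj (h_map c1 c2)"
  using inj_log_homotopy[of c1 1 c2] by (simp add: log_homotopy_1[abs_def])

section \<open>The differential and the distortion\<close>

text \<open>The triangle inequality gives the upper bound; it is attained at a unit vector for which
  the linear and the antilinear term point in the same direction.\<close>

lemma onorm_complex_linear:
  "onorm (\<lambda>b. \<alpha> * b + \<beta> * cnj b) = cmod \<alpha> + cmod \<beta>"
proof (rule antisym)
  have lin: "bounded_linear (\<lambda>b. \<alpha> * b + \<beta> * cnj b)"
    by (intro bounded_linear_add bounded_linear_mult_right
        bounded_linear_compose[OF bounded_linear_mult_right bounded_linear_cnj])
  show "onorm (\<lambda>b. \<alpha> * b + \<beta> * cnj b) \<le> cmod \<alpha> + cmod \<beta>"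
  proof (rule onorm_bound)
    fix b
    have "cmod (\<alpha> * b + \<beta> * cnj b) \<le> cmod (\<alpha> * b) + cmod (\<beta> * cnj b)" by (rule norm_triangle_ineq)
    then show "cmod (\<alpha> * b + \<beta> * cnj b) \<le> (cmod \<alpha> + cmod \<beta>) * cmod b"
      by (simp add: norm_mult algebra_simps)
  qed simp
  have "\<exists>b. cmod b = 1 \<and> cmod (\<alpha> * b + \<beta> * cnj b) = cmod \<alpha> + cmod \<beta>"
  proof (cases "\<alpha> = 0 \<or> \<beta> = 0")
    case True
    then show ?thesis by (intro exI[of _ 1]) auto
  next
    case False
    \<comment> \<open>For |b| = 1, the two terms are aligned when \<open>b^2\<close> is the quotient
      of the directions of \<beta> and \<alpha>.\<close>
    define b where "b = csqrt (sgn \<beta> / sgn \<alpha>)"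
    have b2: "b\<^sup>2 = sgn \<beta> / sgn \<alpha>" by (simp add: b_def)
    have b1: "cmod b = 1"
      using False arg_cong[OF b2, of cmod]
      by (simp add: norm_power norm_divide norm_sgn abs_square_eq_1)
    have "cnj b * b\<^sup>2 = b"
      using b1 by (simp add: power2_eq_square complex_norm_square[symmetric] mult.commute
          flip: mult.assoc)
    then have "\<beta> * cnj b = of_real (cmod \<beta>) * (sgn \<alpha> * b)"
      using False b2 by (simp add: sgn_eq field_simps)
    moreover have "\<alpha> * b = of_real (cmod \<alpha>) * (sgn \<alpha> * b)"
      using False by (simp add: sgn_eq)
    ultimately have "\<alpha> * b + \<beta> * cnj b = of_real (cmod \<alpha> + cmod \<beta>) * (sgn \<alpha> * b)"
      by (simp add: algebra_simps)
    then have "cmod (\<alpha> * b + \<beta> * cnj b) = cmod \<alpha> + cmod \<beta>"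
      using False b1 by (simp only: norm_mult norm_of_real norm_sgn) simp
    with b1 show ?thesis by blast
  qed
  then obtain b where "cmod b = 1" "cmod (\<alpha> * b + \<beta> * cnj b) = cmod \<alpha> + cmod \<beta>"
    by blast
  with onorm[OF lin, of b] show "cmod \<alpha> + cmod \<beta> \<le> onorm (\<lambda>b. \<alpha> * b + \<beta> * cnj b)"
    by simp
qed

lemma jacobian_complex_linear:
  "jacobian (\<lambda>z b. \<alpha> z * b + \<beta> z * cnj b) z = (cmod (\<alpha> z))\<^sup>2 - (cmod (\<beta> z))\<^sup>2"
  by (simp add: jacobian_def cmod_power2) (simp add: power2_eq_square algebra_simps)

text \<open>The coefficients of \<open>b\<close> and \<open>cnj b\<close> are the Wirtinger
  derivatives of \<open>h\<close> with respect to z and its conjugate. For nonzero \<open>z\<close>,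
  \<open>e\<close> is h(z)/z.\<close>

definition h_diff :: "real \<Rightarrow> real \<Rightarrow> complex \<Rightarrow> complex \<Rightarrow> complex" where
  "h_diff c1 c2 z b =
     (let s = ln (cmod z); Q = log_slope c1 c2 s; e = exp (log_profile c1 c2 s - of_real s)
      in e * (Q + 1) / 2 * b + e * (Q - 1) / 2 * (z / cnj z) * cnj b)"

lemma has_derivative_h_map:
  assumes "z \<noteq> 0" "cmod z \<noteq> 1/2" "cmod z \<noteq> 1"
  shows "(h_map c1 c2 has_derivative h_diff c1 c2 z) (at z)"
proof -
  define s Q where "s = ln (cmod z)" and "Q = log_slope c1 c2 s"
  have s: "exp s = cmod z" using assms by (simp add: s_def)
  have "s \<noteq> - ln 2" "s \<noteq> 0" using s assms by (auto simp: exp_minus)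
  then have prof: "(log_profile c1 c2 has_derivative (\<lambda>x. x *\<^sub>R Q)) (at (ln (cmod z)))"
    using has_vector_derivative_log_profile[of s c1 c2] by (simp add: Q_def s_def has_vector_derivative_def)
  have ln: "((\<lambda>z. ln (cmod z)) has_derivative (\<lambda>b. inner z b / (cmod z)\<^sup>2)) (at z)"
  proof -
    have "(cmod has_derivative (\<lambda>b. inner z b / cmod z)) (at z)"
      using has_derivative_norm[OF assms(1)]
      by (simp add: sgn_div_norm divide_inverse mult.commute inner_commute)
    then have "((\<lambda>z. ln (cmod z)) has_derivative
        (\<lambda>b. inner z b / cmod z * inverse (cmod z))) (at z)"
      by (intro has_derivative_ln) (use assms in auto)
    then show ?thesis by (simp add: power2_eq_square divide_inverse mult.assoc)
  qed
  have "((\<lambda>z. log_profile c1 c2 (ln (cmod z)) - of_real (ln (cmod z))) has_derivative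
      (\<lambda>b. (inner z b / (cmod z)\<^sup>2) *\<^sub>R Q - of_real (inner z b / (cmod z)\<^sup>2))) (at z)"
    by (intro has_derivative_diff has_derivative_of_real ln has_derivative_compose[OF ln prof])
  from has_derivative_compose[OF this DERIV_exp[unfolded has_field_derivative_def]]
  have "((\<lambda>z. z * exp (log_profile c1 c2 (ln (cmod z)) - of_real (ln (cmod z)))) has_derivative
      (\<lambda>b. z * (exp (log_profile c1 c2 (ln (cmod z)) - of_real (ln (cmod z)))
             * ((inner z b / (cmod z)\<^sup>2) *\<^sub>R Q - of_real (inner z b / (cmod z)\<^sup>2)))
          + b * exp (log_profile c1 c2 (ln (cmod z)) - of_real (ln (cmod z))))) (at z)"
    by (rule has_derivative_mult[OF has_derivative_ident])
  moreover have "z * (e * ((inner z b / (cmod z)\<^sup>2) *\<^sub>R Q - of_real (inner z b / (cmod z)\<^sup>2))) + b * e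
      = e * (Q + 1) / 2 * b + e * (Q - 1) / 2 * (z / cnj z) * cnj b" for b e
  proof -
    \<comment> \<open>Splits the differential of \<open>ln (cmod z)\<close>, multiplied by
      \<open>z\<close>, into its complex linear and antilinear parts.\<close>
    have "z * of_real (inner z b / (cmod z)\<^sup>2) = (b + (z / cnj z) * cnj b) / 2"
    proof -
      have "of_real (inner z b) = (b * cnj z + z * cnj b) / 2"
        by (simp add: complex_eq_iff inner_complex_def)
      moreover have "of_real ((cmod z)\<^sup>2) = z * cnj z" by (rule complex_norm_square)
      ultimately show ?thesis using assms(1) by (simp add: field_simps)
    qed
    moreover have "z * (e * (t *\<^sub>R Q - of_real t)) = (Q - 1) * e * (z * of_real t)" for t
      by (simp add: scaleR_conv_of_real algebra_simps)
    ultimately have *: "z * (e * ((inner z b / (cmod z)\<^sup>2) *\<^sub>R Q - of_real (inner z b / (cmod z)\<^sup>2)))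
        = (Q - 1) * e * ((b + (z / cnj z) * cnj b) / 2)"
      by (simp only:)
    define w where "w = z / cnj z"
    show ?thesis unfolding * w_def[symmetric] by (simp add: field_simps)
  qed
  ultimately show ?thesis
    by (simp add: h_map_conv_log_profile[abs_def] h_diff_def[abs_def] Let_def Q_def s_def)
qed

lemma AE_has_derivative_h_map:
  "AE z in lborel. (h_map c1 c2 has_derivative h_diff c1 c2 z) (at z)"
proof -
  have "AE z in lebesgue. z \<notin> sphere (0::complex) r" for r
    by (intro AE_not_in) (simp add: negligible_sphere flip: negligible_iff_null_sets)
  then have "AE z in lborel. z \<notin> sphere (0::complex) (1/2)" "AE z in lborel. z \<notin> sphere (0::complex) 1"
    by (simp_all only: AE_completion_iff)
  moreover have "AE z in lborel. z \<noteq> (0::complex)" by (rule AE_lborel_singleton)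
  ultimately show ?thesis
    by eventually_elim (intro has_derivative_h_map, auto)
qed

lemma borel_measurable_h_diff [measurable]: "(\<lambda>z. h_diff c1 c2 z b) \<in> borel_measurable borel"
proof -
  have [measurable]: "cnj \<in> borel_measurable borel"
    by (intro borel_measurable_continuous_onI continuous_intros)
  show ?thesis unfolding h_diff_def Let_def by measurable
qed

text \<open>At \<open>z = 0\<close> the junk value \<open>0 / 0 = 0\<close> is harmless: \<open>ln 0 = 0\<close> gives \<open>log_slope = 1\<close>, so the
  antilinear part vanishes.\<close>

lemma h_diff_wirtinger_norms:
  fixes z c1 c2
  defines "s \<equiv> ln (cmod z)"
  defines "Q \<equiv> log_slope c1 c2 s" and "E \<equiv> exp (Re (log_profile c1 c2 s) - s)"
  obtains \<alpha> \<beta> where "h_diff c1 c2 z = (\<lambda>b. \<alpha> * b + \<beta> * cnj b)"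
    "cmod \<alpha> = E * cmod (Q + 1) / 2" "cmod \<beta> = E * cmod (Q - 1) / 2"
proof
  define e where "e = exp (log_profile c1 c2 s - of_real s)"
  have e: "cmod e = E" by (simp add: e_def E_def)
  show "h_diff c1 c2 z = (\<lambda>b. (e * (Q + 1) / 2) * b + (e * (Q - 1) / 2 * (z / cnj z)) * cnj b)"
    by (simp add: h_diff_def[abs_def] Let_def e_def Q_def s_def)
  show "cmod (e * (Q + 1) / 2) = E * cmod (Q + 1) / 2" by (simp add: norm_mult norm_divide e)
  show "cmod (e * (Q - 1) / 2 * (z / cnj z)) = E * cmod (Q - 1) / 2"
  proof (cases "z = 0")
    case True
    then have "Q = 1" by (simp add: Q_def s_def log_slope_def)
    then show ?thesis by simp
  qed (simp add: norm_mult norm_divide e)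
qed

lemma linear_h_diff: "linear (h_diff c1 c2 z)"
proof -
  obtain \<alpha> \<beta> where h: "h_diff c1 c2 z = (\<lambda>b. \<alpha> * b + \<beta> * cnj b)"
    by (rule h_diff_wirtinger_norms[of c1 c2 z])
  show ?thesis unfolding h by (rule linearI) (simp_all add: algebra_simps)
qed

lemma cmod_add_1_minus_1: "(cmod (Q + 1))\<^sup>2 - (cmod (Q - 1))\<^sup>2 = 4 * Re Q"
  "(cmod (Q + 1))\<^sup>2 + (cmod (Q - 1))\<^sup>2 = 2 * (cmod Q)\<^sup>2 + 2"
  unfolding cmod_power2 by (simp_all add: power2_eq_square algebra_simps)

text \<open>In logarithmic coordinates the partial derivatives are \<open>Q\<close> and
  \<open>\<i>\<close>, with determinant \<open>Re Q\<close>. The squared exponential is the factor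
  from the conformal changes of coordinates; here it comes out of the Wirtinger
  coefficients.\<close>

lemma jacobian_h_diff:
  "jacobian (h_diff c1 c2) z =
     (exp (Re (log_profile c1 c2 (ln (cmod z))) - ln (cmod z)))\<^sup>2 * Re (log_slope c1 c2 (ln (cmod z)))"
proof -
  define Q E where "Q = log_slope c1 c2 (ln (cmod z))"
    and "E = exp (Re (log_profile c1 c2 (ln (cmod z))) - ln (cmod z))"
  obtain \<alpha> \<beta> where h: "h_diff c1 c2 z = (\<lambda>b. \<alpha> * b + \<beta> * cnj b)"
    and n: "cmod \<alpha> = E * cmod (Q + 1) / 2" "cmod \<beta> = E * cmod (Q - 1) / 2"
    unfolding Q_def E_def by (rule h_diff_wirtinger_norms[of c1 c2 z])
  have "jacobian (h_diff c1 c2) z = jacobian (\<lambda>z b. \<alpha> * b + \<beta> * cnj b) z"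
    unfolding jacobian_def h ..
  also have "\<dots> = E\<^sup>2 * ((cmod (Q + 1))\<^sup>2 - (cmod (Q - 1))\<^sup>2) / 4"
    unfolding jacobian_complex_linear n by (simp add: power_mult_distrib power_divide algebra_simps)
  finally show ?thesis unfolding cmod_add_1_minus_1 by (simp add: Q_def E_def)
qed

lemma onorm_h_diff:
  "onorm (h_diff c1 c2 z) = exp (Re (log_profile c1 c2 (ln (cmod z))) - ln (cmod z)) *
     (cmod (log_slope c1 c2 (ln (cmod z)) + 1) + cmod (log_slope c1 c2 (ln (cmod z)) - 1)) / 2"
proof -
  define Q E where "Q = log_slope c1 c2 (ln (cmod z))"
    and "E = exp (Re (log_profile c1 c2 (ln (cmod z))) - ln (cmod z))"
  obtain \<alpha> \<beta> where h: "h_diff c1 c2 z = (\<lambda>b. \<alpha> * b + \<beta> * cnj b)"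
    and n: "cmod \<alpha> = E * cmod (Q + 1) / 2" "cmod \<beta> = E * cmod (Q - 1) / 2"
    unfolding Q_def E_def by (rule h_diff_wirtinger_norms[of c1 c2 z])
  have "onorm (h_diff c1 c2 z) = E * (cmod (Q + 1) + cmod (Q - 1)) / 2"
    unfolding h onorm_complex_linear n by (simp add: field_simps)
  then show ?thesis by (simp only: Q_def E_def)
qed

lemma h_diff_bounded:
  assumes "c1 > 0"
  obtains M where "M > 0" "\<And>z b. cmod (h_diff c1 c2 z b) \<le> M * cmod b"
proof -
  obtain M where M: "M > 0"
    and bd: "\<And>s. exp (Re (log_profile c1 c2 s) - s) * (1 + cmod (log_slope c1 c2 s)) \<le> M"
    using log_slope_growth[OF assms] by blast
  have "cmod (h_diff c1 c2 z b) \<le> M * cmod b" for z b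
  proof -
    define Q where "Q = log_slope c1 c2 (ln (cmod z))"
    have "cmod (Q + 1) + cmod (Q - 1) \<le> 2 * (1 + cmod Q)"
      using norm_triangle_ineq[of Q 1] norm_triangle_ineq4[of Q 1] by simp
    then have "onorm (h_diff c1 c2 z) \<le> exp (Re (log_profile c1 c2 (ln (cmod z))) - ln (cmod z)) * (1 + cmod Q)"
      unfolding onorm_h_diff Q_def by simp
    also have "\<dots> \<le> M" unfolding Q_def by (rule bd)
    finally have "onorm (h_diff c1 c2 z) * cmod b \<le> M * cmod b" by (rule mult_right_mono) simp
    moreover have "cmod (h_diff c1 c2 z b) \<le> onorm (h_diff c1 c2 z) * cmod b"
      by (intro onorm) (simp add: linear_h_diff linear_conv_bounded_linear[symmetric])
    ultimately show ?thesis by linarith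
  qed
  with M show ?thesis by (rule that)
qed

section \<open>The distortion function\<close>

text \<open>The quotient of the squared operator norm by the Jacobian; the common scale factor has
  cancelled, and \<open>4 * Re Q\<close> is the difference of the squares of |Q + 1| and |Q -
  1|.\<close>

definition h_distortion :: "real \<Rightarrow> real \<Rightarrow> complex \<Rightarrow> real" where
  "h_distortion c1 c2 z =
     (let Q = log_slope c1 c2 (ln (cmod z)) in (cmod (Q + 1) + cmod (Q - 1))\<^sup>2 / (4 * Re Q))"

lemma borel_measurable_h_distortion [measurable]: "h_distortion c1 c2 \<in> borel_measurable borel"
  unfolding h_distortion_def Let_def by measurable

lemma onorm_h_diff_eq_h_distortion:
  assumes "c1 > 0"
  shows "(onorm (h_diff c1 c2 z))\<^sup>2 = jacobian (h_diff c1 c2) z * h_distortion c1 c2 z"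
  using Re_log_slope_pos[OF assms, of c2 "ln (cmod z)"]
  by (simp add: onorm_h_diff jacobian_h_diff h_distortion_def Let_def power_mult_distrib power_divide)

lemma jacobian_h_diff_pos: "c1 > 0 \<Longrightarrow> jacobian (h_diff c1 c2) z > 0"
  by (simp add: jacobian_h_diff Re_log_slope_pos)

lemma h_distortion_ge_1:
  assumes "c1 > 0"
  shows "1 \<le> h_distortion c1 c2 z"
proof -
  define Q where "Q = log_slope c1 c2 (ln (cmod z))"
  have Q: "Re Q > 0" using Re_log_slope_pos[OF assms] by (simp add: Q_def)
  have "4 * Re Q \<le> (cmod (Q + 1))\<^sup>2" 
    using cmod_add_1_minus_1(1)[of Q] zero_le_power2[of "cmod (Q - 1)"] by linarith
  also have "\<dots> \<le> (cmod (Q + 1) + cmod (Q - 1))\<^sup>2" by (intro power_mono) auto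
  finally show ?thesis using Q by (simp add: h_distortion_def Let_def flip: Q_def)
qed

text \<open>The square of a sum is at most twice the sum of squares, and the parallelogram law
  evaluates the latter. The loss is at most \<open>1 / Re Q\<close>, so the leading growth at the
  origin is kept.\<close>

lemma h_distortion_le:
  assumes "c1 > 0"
  shows "h_distortion c1 c2 z \<le>
    (1 + (cmod (log_slope c1 c2 (ln (cmod z))))\<^sup>2) / Re (log_slope c1 c2 (ln (cmod z)))"
proof -
  define Q where "Q = log_slope c1 c2 (ln (cmod z))"
  have Q: "Re Q > 0" using Re_log_slope_pos[OF assms] by (simp add: Q_def)
  have "(cmod (Q + 1) + cmod (Q - 1))\<^sup>2 \<le> 2 * ((cmod (Q + 1))\<^sup>2 + (cmod (Q - 1))\<^sup>2)"
    using sum_squares_bound[of "cmod (Q + 1)" "cmod (Q - 1)"] by (simp add: power2_sum)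
  also have "\<dots> = 4 * (1 + (cmod Q)\<^sup>2)" unfolding cmod_add_1_minus_1 by simp
  finally have "h_distortion c1 c2 z \<le> 4 * (1 + (cmod Q)\<^sup>2) / (4 * Re Q)"
    unfolding h_distortion_def Let_def Q_def[symmetric] using Q by (intro divide_right_mono) auto
  then show ?thesis unfolding Q_def by (subst (asm) mult_divide_mult_cancel_left) auto
qed

lemma weak_differential_h_map:
  assumes "c1 > 0"
  shows "weak_differential UNIV (h_map c1 c2) (h_diff c1 c2)"
  unfolding weak_differential_def
proof (intro conjI ballI)
  obtain L where L: "L-lipschitz_on UNIV (h_map c1 c2)" using lipschitz_h_map[OF assms] .
  then have cont: "continuous_on UNIV (h_map c1 c2)" by (rule lipschitz_on_continuous_on)
  obtain M where M: "\<And>z b. cmod (h_diff c1 c2 z b) \<le> M * cmod b"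
    using h_diff_bounded[OF assms] by metis
  show "linear (h_diff c1 c2 z)" for z by (rule linear_h_diff)
  show "locally_integrable UNIV (h_map c1 c2)"
  proof (rule locally_integrable_locally_bounded)
    show "h_map c1 c2 \<in> borel_measurable borel" by (rule borel_measurable_continuous_onI[OF cont])
    fix C :: "complex set" assume "compact C"
    then have "compact (h_map c1 c2 ` C)"
      by (intro compact_continuous_image continuous_on_subset[OF cont]) auto
    then show "\<exists>B. \<forall>z\<in>C. norm (h_map c1 c2 z) \<le> B"
      by (force dest!: compact_imp_bounded simp: bounded_iff)
  qed
  fix b :: complex assume b: "b \<in> {1, \<i>}"
  then have "cmod b = 1" by auto
  then have bd: "cmod (h_diff c1 c2 z b) \<le> M" for z using M[of z b] by simp
  then show "locally_integrable UNIV (\<lambda>z. h_diff c1 c2 z b)"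
    by (rule locally_integrable_bounded[rotated]) simp
  show "weak_partial UNIV b (h_map c1 c2) (\<lambda>z. h_diff c1 c2 z b)"
    by (rule weak_partial_lipschitz[OF L AE_has_derivative_h_map _ bd b]) simp
qed

lemma locally_integrable_jacobian_h_diff:
  assumes "c1 > 0"
  shows "locally_integrable UNIV (jacobian (h_diff c1 c2))"
proof -
  obtain M where M: "M > 0" "\<And>z b. cmod (h_diff c1 c2 z b) \<le> M * cmod b"
    using h_diff_bounded[OF assms] by metis
  have "\<bar>jacobian (h_diff c1 c2) z\<bar> \<le> M * M + M * M" for z
  proof -
    have *: "\<bar>Re (h_diff c1 c2 z b)\<bar> \<le> M" "\<bar>Im (h_diff c1 c2 z b)\<bar> \<le> M" if "cmod b = 1" for b
      using M(2)[of z b] abs_Re_le_cmod abs_Im_le_cmod that by (auto intro: order_trans)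
    have "\<bar>jacobian (h_diff c1 c2) z\<bar> \<le> \<bar>Re (h_diff c1 c2 z 1)\<bar> * \<bar>Im (h_diff c1 c2 z \<i>)\<bar>
        + \<bar>Im (h_diff c1 c2 z 1)\<bar> * \<bar>Re (h_diff c1 c2 z \<i>)\<bar>"
      unfolding jacobian_def by (metis abs_mult abs_triangle_ineq4)
    also have "\<dots> \<le> M * M + M * M"
      by (intro add_mono mult_mono *) (use M(1) in auto)
    finally show ?thesis .
  qed
  moreover have "jacobian (h_diff c1 c2) \<in> borel_measurable borel"
    unfolding jacobian_def[abs_def] by measurable
  ultimately show ?thesis by (intro locally_integrable_bounded[of _ "M * M + M * M"]) auto
qed

lemma distortion_bound_h_distortion:
  assumes "c1 > 0"
  shows "distortion_bound UNIV (h_diff c1 c2) (\<lambda>z. ereal (h_distortion c1 c2 z))"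
  unfolding distortion_bound_def
proof (intro conjI)
  show "(\<lambda>z. ereal (h_distortion c1 c2 z)) \<in> borel_measurable (lebesgue_on UNIV)"
    by (intro measurable_restrict_space1 measurable_completion) simp
qed (use assms in \<open>auto simp: h_distortion_ge_1 onorm_h_diff_eq_h_distortion\<close>)

text \<open>The distortion inequality is an equality for \<open>h_distortion\<close>, and the
  Jacobian is positive everywhere, so it can be divided out of the inequality for any
  competitor.\<close>

lemma is_distortion_function_h_distortion:
  assumes "c1 > 0"
  shows "is_distortion_function UNIV (h_map c1 c2) (\<lambda>z. ereal (h_distortion c1 c2 z))"
  unfolding is_distortion_function_def
proof (intro exI[of _ "h_diff c1 c2"] conjI allI impI)
  fix K' assume "distortion_bound UNIV (h_diff c1 c2) K'"
  then have "AE z in lebesgue_on UNIV.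
      ereal ((onorm (h_diff c1 c2 z))\<^sup>2) \<le> ereal (jacobian (h_diff c1 c2) z) * K' z"
    by (simp add: distortion_bound_def)
  then show "AE z in lebesgue_on UNIV. ereal (h_distortion c1 c2 z) \<le> K' z"
  proof eventually_elim
    fix z assume "ereal ((onorm (h_diff c1 c2 z))\<^sup>2) \<le> ereal (jacobian (h_diff c1 c2) z) * K' z"
    \<comment> \<open>An infinite \<open>K' z\<close> is trivially large enough; the value minus
      infinity would contradict the inequality, as the Jacobian is positive.\<close>
    then show "ereal (h_distortion c1 c2 z) \<le> K' z"
      using jacobian_h_diff_pos[OF assms, of c2 z]
      by (cases "K' z") (auto simp: onorm_h_diff_eq_h_distortion[OF assms])
  qed
qed (simp_all add: assms weak_differential_h_map distortion_bound_h_distortion)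

lemma finite_distortion_h_map:
  assumes "c1 > 0"
  shows "finite_distortion UNIV (h_map c1 c2)"
  unfolding finite_distortion_def
proof (intro conjI exI[of _ "h_diff c1 c2"] exI[of _ "\<lambda>z. ereal (h_distortion c1 c2 z)"])
  obtain L where "L-lipschitz_on UNIV (h_map c1 c2)" using lipschitz_h_map[OF assms] .
  then have "continuous_on UNIV (h_map c1 c2)" by (rule lipschitz_on_continuous_on)
  \<comment> \<open>Invariance of domain supplies the continuity of the inverse.\<close>
  with inj_h_map[OF assms] obtain g where "homeomorphism UNIV (range (h_map c1 c2)) (h_map c1 c2) g"
    by (metis invariance_of_domain_homeomorphism open_UNIV order_refl)
  then show "\<exists>g. homeomorphism UNIV (range (h_map c1 c2)) (h_map c1 c2) g" by blast
qed (simp_all add: assms connected_UNIV sense_preserving_h_map surj_h_map weak_differential_h_map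
    locally_integrable_jacobian_h_diff distortion_bound_h_distortion)

section \<open>Exponential integrability of the distortion\<close>

text \<open>The hypothesis says \<open>p * \<kappa> < 1\<close>, which is exactly that the singular
  exponent \<open>2 * p * \<kappa>\<close> stays below 2.\<close>

lemma locally_integrable_exp_h_distortion:
  assumes p: "p > 0" and c: "c1 > 0" "c1 + c2\<^sup>2 / c1 < 1 / p"
  shows "locally_integrable UNIV (\<lambda>z. exp (p * h_distortion c1 c2 z))"
proof -
  define \<kappa> where "\<kappa> = c1 + c2\<^sup>2 / c1"
  have \<kappa>: "0 \<le> \<kappa>" "p * \<kappa> < 1" using p c by (simp_all add: \<kappa>_def field_simps)
  have l2: "ln (2::real) > 0" by simp
  have "c1 * \<kappa> = c1\<^sup>2 + c2\<^sup>2"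
    using c by (simp add: \<kappa>_def field_simps power2_eq_square)
  then have C: "(cmod (Complex c1 (- c2)))\<^sup>2 = c1 * \<kappa>" by (simp add: cmod_power2)
  \<comment> \<open>\<open>K2\<close> is the bound of \<open>h_distortion_le\<close> on the middle
    annulus; where |z| is at least 1 the slope is 1 and the bound is 2. \<open>A\<close> absorbs the
    term \<open>1 / (2 * l * c1)\<close>, since \<open>l > ln 2\<close> in the inner disc.\<close>
  define K2 where "K2 = (1 + (ln 2)\<^sup>2 * (c1 * \<kappa>)) / (ln 2 * c1)"
  define B where "B = exp (p * (K2 + 2))"
  define A where "A = exp (p * (1 / (2 * ln 2 * c1)))"
  have K2: "K2 \<ge> 0" using c \<kappa> l2 by (simp add: K2_def)
  have outer: "exp (p * h_distortion c1 c2 z) \<le> B" if "\<not> ln (cmod z) < - ln 2" for z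
  proof -
    have "h_distortion c1 c2 z \<le> K2 + 2"
    proof (cases "ln (cmod z) < 0")
      case True
      with that h_distortion_le[OF c(1), of c2 z] show ?thesis
        by (simp add: log_slope_def norm_mult power_mult_distrib C K2_def)
    next
      case False
      with that h_distortion_le[OF c(1), of c2 z] K2 show ?thesis
        by (simp add: log_slope_def)
    qed
    then show ?thesis using p by (simp add: B_def)
  qed
  have inner: "exp (p * h_distortion c1 c2 z) \<le> A * cmod z powr - (2 * p * \<kappa>)"
    if "z \<noteq> 0" "ln (cmod z) < - ln 2" for z
  proof -
    define l where "l = - ln (cmod z)"
    have l: "l > ln 2" "l > 0" using that(2) l2 unfolding l_def by linarith+
    have Q: "log_slope c1 c2 (ln (cmod z)) = of_real (2 * l) * Complex c1 (- c2)"
      using that(2) by (simp add: log_slope_def l_def)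
    have "(cmod (log_slope c1 c2 (ln (cmod z))))\<^sup>2 = (2 * l)\<^sup>2 * (c1 * \<kappa>)"
      unfolding Q norm_mult power_mult_distrib C by simp
    moreover have "Re (log_slope c1 c2 (ln (cmod z))) = 2 * l * c1" unfolding Q by simp
    ultimately have "h_distortion c1 c2 z \<le> (1 + (2 * l)\<^sup>2 * (c1 * \<kappa>)) / (2 * l * c1)"
      using h_distortion_le[OF c(1), of c2 z] by (simp only:)
    also have "\<dots> = 1 / (2 * l * c1) + 2 * l * \<kappa>"
      using l c by (simp add: add_divide_distrib power2_eq_square)
    also have "1 / (2 * l * c1) \<le> 1 / (2 * ln 2 * c1)"
      by (rule frac_le) (use l c l2 in auto)
    finally have "p * h_distortion c1 c2 z \<le> p * (1 / (2 * ln 2 * c1) + 2 * l * \<kappa>)"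
      using p by (intro mult_left_mono) auto
    then have "exp (p * h_distortion c1 c2 z) \<le> exp (p * (1 / (2 * ln 2 * c1) + 2 * l * \<kappa>))" by simp
    also have "\<dots> = A * exp (2 * p * \<kappa> * l)"
      unfolding A_def exp_add[symmetric] by (simp add: algebra_simps)
    also have "exp (2 * p * \<kappa> * l) = cmod z powr - (2 * p * \<kappa>)"
      using that by (simp add: powr_def l_def)
    finally show ?thesis .
  qed
  show ?thesis
  proof (rule locally_integrable_singular_bound[of _ "2 * p * \<kappa>" A B])
    show "(\<lambda>z. exp (p * h_distortion c1 c2 z)) \<in> borel_measurable borel"
      by (intro measurable_compose[OF _ borel_measurable_exp] borel_measurable_times) auto
    show "\<bar>exp (p * h_distortion c1 c2 z)\<bar> \<le> A * cmod z powr - (2 * p * \<kappa>) + B"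
      if "0 < cmod z" "cmod z < 1" for z
    proof -
      have "0 \<le> A * cmod z powr - (2 * p * \<kappa>)" "0 \<le> B" by (simp_all add: A_def B_def)
      moreover have "exp (p * h_distortion c1 c2 z) \<le> A * cmod z powr - (2 * p * \<kappa>) \<or>
          exp (p * h_distortion c1 c2 z) \<le> B"
        using inner[of z] outer[of z] that by (cases "ln (cmod z) < - ln 2") simp_all
      ultimately show ?thesis by (simp only: abs_exp_cancel) linarith
    qed
    show "\<bar>exp (p * h_distortion c1 c2 z)\<bar> \<le> B" if "z = 0 \<or> 1 \<le> cmod z" for z
    proof -
      \<comment> \<open>The convention \<open>ln 0 = 0\<close> places the origin in the outer range,
        where \<open>B\<close> suffices.\<close>
      have "0 \<le> ln (cmod z)" using that by auto
      with l2 have "\<not> ln (cmod z) < - ln 2" by linarith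
      then show ?thesis using outer by simp
    qed
  qed (use p \<kappa> in \<open>auto simp: A_def\<close>)
qed

section \<open>The argument on the positive axis\<close>

text \<open>Two branches differ by an integer multiple of \<open>2 * pi\<close> at each point. The
  multiple is continuous on the connected half-line, hence constant, and it is 0 at 1.\<close>

lemma arg_branch_unique:
  assumes a: "arg_branch f a" and b: "arg_branch f b"
    and nz: "\<And>r. r > 0 \<Longrightarrow> f (of_real r) \<noteq> 0" and r: "r > 0"
  shows "a r = b r"
proof -
  define g where "g r = (a r - b r) / (2 * pi)" for r
  have int: "\<exists>n::int. g r = of_int n" if "r > 0" for r
  proof -
    have "of_real (cmod (f (of_real r))) * exp (\<i> * of_real (a r)) =
        of_real (cmod (f (of_real r))) * exp (\<i> * of_real (b r))"
      using a b that unfolding arg_branch_def by metis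
    then have "exp (\<i> * of_real (a r)) = exp (\<i> * of_real (b r))"
      using nz[OF that] by simp
    then obtain n :: int
      where "\<i> * of_real (a r) = \<i> * of_real (b r) + of_real (real_of_int (2 * n) * pi) * \<i>"
      unfolding exp_eq by blast
    from arg_cong[OF this, of Im] have "a r = b r + 2 * pi * n" by simp
    then show ?thesis by (intro exI[of _ n]) (simp add: g_def)
  qed
  have "g constant_on {0<..}"
  proof (rule continuous_discrete_range_constant)
    show "continuous_on {0<..} g"
      using a b unfolding g_def arg_branch_def by (intro continuous_intros) auto
    fix x :: real assume x: "x \<in> {0<..}"
    show "\<exists>e>0. \<forall>y. y \<in> {0<..} \<and> g y \<noteq> g x \<longrightarrow> e \<le> norm (g y - g x)"
    proof (intro exI[of _ 1] conjI allI impI)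
      fix y assume y: "y \<in> {0<..} \<and> g y \<noteq> g x"
      from int[of x] int[of y] x y obtain m n :: int where "g x = of_int m" "g y = of_int n" by auto
      with y show "1 \<le> norm (g y - g x)"
        by (simp flip: of_int_diff of_int_abs) linarith
    qed simp
  qed (simp add: is_interval_1 is_interval_connected)
  then have "g r = g 1" using r unfolding constant_on_def by auto
  also have "\<dots> = 0" using a b by (simp add: g_def arg_branch_def)
  finally show ?thesis by (simp add: g_def)
qed

lemma arg_on_axis_eq:
  assumes "arg_branch f a" "\<And>r. r > 0 \<Longrightarrow> f (of_real r) \<noteq> 0" "r > 0"
  shows "arg_on_axis f r = a r"
  unfolding arg_on_axis_def
  by (rule the_equality) (use assms arg_branch_unique[of f _ a r] in blast)+

text \<open>On the positive axis \<open>h\<close> is the exponential of the profile at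
  \<open>ln r\<close>, so the imaginary part of the profile is a continuous argument; the profile
  vanishes at \<open>ln 1 = 0\<close>.\<close>

lemma arg_branch_h_map: "arg_branch (h_map c1 c2) (\<lambda>r. Im (log_profile c1 c2 (ln r)))"
  unfolding arg_branch_def
proof (intro conjI allI impI)
  show "continuous_on {0<..} (\<lambda>r. Im (log_profile c1 c2 (ln r)))"
    by (intro continuous_intros) auto
  fix r :: real assume r: "r > 0"
  have "h_map c1 c2 (of_real r) = exp (log_profile c1 c2 (ln r))"
    using r by (simp add: h_map_conv_log_profile exp_diff exp_of_real)
  then show "h_map c1 c2 (of_real r) = of_real (cmod (h_map c1 c2 (of_real r)))
      * exp (\<i> * of_real (Im (log_profile c1 c2 (ln r))))"
    by (simp add: exp_eq_polar[of "log_profile c1 c2 (ln r)"] cis_conv_exp norm_mult)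
qed simp

lemma arg_on_axis_h_map:
  assumes "0 < r" "r < 1/2"
  shows "arg_on_axis (h_map c1 c2) r = c2 * (ln (1 / r))\<^sup>2"
proof -
  have "arg_on_axis (h_map c1 c2) r = Im (log_profile c1 c2 (ln r))"
    by (rule arg_on_axis_eq[OF arg_branch_h_map _ assms(1)]) (simp add: h_map_conv_log_profile)
  moreover have "ln r \<le> - ln 2"
    using assms ln_le_cancel_iff[of r "1/2"] by (simp add: ln_div)
  ultimately show ?thesis using assms by (simp add: log_profile_inner ln_div power2_eq_square)
qed

theorem mainTheorem2:
  fixes p :: real
  assumes "p > 0"
  shows "(\<forall>c1 c2. c1 > 0 \<and> c1 + c2\<^sup>2 / c1 < 1 / p \<longrightarrow>
            finite_distortion UNIV (h_map c1 c2) \<and>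
            (\<exists>K. is_distortion_function UNIV (h_map c1 c2) K \<and>
                 locally_integrable UNIV (\<lambda>z. exp (p * real_of_ereal (K z)))) \<and>
            h_map c1 c2 0 = 0 \<and> h_map c1 c2 1 = 1) \<and>
         (\<forall>\<epsilon>. 0 < \<epsilon> \<and> \<epsilon> \<le> 1 \<longrightarrow>
            (\<exists>c1 c2. c1 > 0 \<and> c1 + c2\<^sup>2 / c1 < 1 / p \<and>
               (\<forall>r. 0 < r \<and> r < 1/2 \<longrightarrow>
                  \<bar>arg_on_axis (h_map c1 c2) r\<bar> = (1 - \<epsilon>) / (2 * p) * (ln (1 / r))\<^sup>2)))"
proof (intro conjI allI impI)
  fix c1 c2 :: real assume c: "c1 > 0 \<and> c1 + c2\<^sup>2 / c1 < 1 / p"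
  then show "finite_distortion UNIV (h_map c1 c2)" by (intro finite_distortion_h_map) simp
  show "\<exists>K. is_distortion_function UNIV (h_map c1 c2) K \<and>
      locally_integrable UNIV (\<lambda>z. exp (p * real_of_ereal (K z)))"
    using c assms
    by (intro exI[of _ "\<lambda>z. ereal (h_distortion c1 c2 z)"])
      (simp add: is_distortion_function_h_distortion locally_integrable_exp_h_distortion)
  show "h_map c1 c2 0 = 0" "h_map c1 c2 1 = 1" by (simp_all add: h_map_def)
next
  fix \<epsilon> :: real assume \<epsilon>: "0 < \<epsilon> \<and> \<epsilon> \<le> 1"
  \<comment> \<open>For \<open>c1 > 0\<close> the condition describes the open disc of centre
    \<open>(1 / (2 * p), 0)\<close> and radius \<open>1 / (2 * p)\<close> in the
    \<open>(c1, c2)\<close> plane. The central \<open>c1\<close> leaves most room for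
    \<open>c2\<close>, and \<open>c2\<close> takes the fraction \<open>1 - \<epsilon>\<close> of the
    radius.\<close>
  define c1 c2 where "c1 = 1 / (2 * p)" and "c2 = (1 - \<epsilon>) / (2 * p)"
  have "(1 - \<epsilon>)\<^sup>2 < 1" using \<epsilon> by (simp add: power_less_one_iff abs_square_less_1)
  then have "(1 + (1 - \<epsilon>)\<^sup>2) / (2 * p) < 1 / p" using assms by (simp add: field_simps)
  moreover have "c1 + c2\<^sup>2 / c1 = (1 + (1 - \<epsilon>)\<^sup>2) / (2 * p)"
    using assms by (simp add: c1_def c2_def field_simps power2_eq_square)
  ultimately have "c1 + c2\<^sup>2 / c1 < 1 / p" by simp
  moreover have "c1 > 0" using assms by (simp add: c1_def)
  moreover have "\<bar>arg_on_axis (h_map c1 c2) r\<bar> = (1 - \<epsilon>) / (2 * p) * (ln (1 / r))\<^sup>2"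
    if "0 < r \<and> r < 1/2" for r
    using that \<epsilon> assms by (simp add: arg_on_axis_h_map abs_mult c2_def)
  ultimately show "\<exists>c1 c2. c1 > 0 \<and> c1 + c2\<^sup>2 / c1 < 1 / p \<and>
      (\<forall>r. 0 < r \<and> r < 1/2 \<longrightarrow>
        \<bar>arg_on_axis (h_map c1 c2) r\<bar> = (1 - \<epsilon>) / (2 * p) * (ln (1 / r))\<^sup>2)"
    by blast
qed

end
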